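(* Let $m>n$ be positive integers, let $Z=m_1P_1+\cdots+m_sP_s$ be fat points in $\mathbb P^n$ (with $P_1,\dots,P_s$ distinct points and $m_1,\dots,m_s$ positive integers), and let $\phi_{n,m}:\mathbb P^n\to\mathbb P^m$ be the embedding. If $0\le t<\operatorname{reg}(R_n/I_Z)$, then $$H_{R_m/I_{\phi_{n,m}(Z)}}(t)=H_{R_n/I_Z}(t)+\binom{t+m}{m}-\binom{t+n}{n}-\sum_{i=0}^{t-1}\binom{m-n-1+t-i}{t-i}\left(\binom{i+n}{n}-H_{R_n/(\wp_1^{m_1-t+i}\cap\cdots\cap\wp_s^{m_s-t+i})}(i)\right).$$
   Context: $K$ is an algebraically closed field, $\mathbb P^n$ is the $n$-dimensional projective space over $K$, and $R_n=K[X_0,\dots,X_n]$ (similarly $R_m=K[X_0,\dots,X_m]\supset R_n$), with the standard grading. Given distinct points $P_1,\dots,P_s\in\mathbb P^n$ and positive integers $m_1,\dots,m_s$, let $\wp_i\subset R_n$ be the homogeneous prime ideal of $P_i$; the fat points $Z=m_1P_1+\cdots+m_sP_s$ is the zero-scheme defined by $I_Z=\wp_1^{m_1}\cap\cdots\cap\wp_s^{m_s}$. Convention: $\wp_i^r=R_n$ whenever $r\le 0$. For a homogeneous ideal $I\subset R_n$, the Hilbert function is $H_{R_n/I}(t)=\dim_K(R_n/I)_t$. The multiplicity is $e(R_n/I_Z)=\sum_{i=1}^s\binom{m_i+n-1}{n}$ and the regularity index is $\operatorname{reg}(R_n/I_Z)=\min\{t\in\mathbb N\mid H_{R_n/I_Z}(t)=e(R_n/I_Z)\}$.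 For $m>n$ the embedding $\phi_{n,m}:\mathbb P^n\to\mathbb P^m$ is $(a_0,\dots,a_n)\mapsto(a_0,\dots,a_n,0,\dots,0)$ in homogeneous coordinates. Let $\mathfrak q_i\subset R_m$ be the homogeneous prime ideal of $\phi_{n,m}(P_i)$; then $\phi_{n,m}(Z)=m_1\phi_{n,m}(P_1)+\cdots+m_s\phi_{n,m}(P_s)$ is the fat points in $\mathbb P^m$ defined by $I_{\phi_{n,m}(Z)}=\mathfrak q_1^{m_1}\cap\cdots\cap\mathfrak q_s^{m_s}$. *)

theory Defs
  imports
    "HOL-Library.Poly_Mapping"
    "HOL-Computational_Algebra.Polynomial"
    "HOL-Algebra.Embedded_Algebras"
    "HOL-Algebra.QuotRing"
    "HOL-Algebra.Ideal_Product"
begin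

text \<open>
  Multivariate polynomials over \<open>'a\<close> are finitely supported functions from monomials
  (exponent functions \<open>nat \<Rightarrow>\<^sub>0 nat\<close>) to coefficients, with the convolution product of
  \<^theory>\<open>HOL-Library.Poly_Mapping\<close>.  The variables are $X_0, X_1, \ldots$; since all the
  rings $R_n$ live in one type, the inclusion of $R_n$ in $R_m$ for $n \le m$ is literal.
\<close>

type_synonym 'a mpol = "(nat \<Rightarrow>\<^sub>0 nat) \<Rightarrow>\<^sub>0 'a"

definition mon_deg :: "(nat \<Rightarrow>\<^sub>0 nat) \<Rightarrow> nat" where
  "mon_deg u = (\<Sum>i\<in>Poly_Mapping.keys u. Poly_Mapping.lookup u i)"

definition eval_mpol :: "'a::field mpol \<Rightarrow> 'a list \<Rightarrow> 'a" where
  "eval_mpol p a =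
     (\<Sum>u\<in>Poly_Mapping.keys p.
        Poly_Mapping.lookup p u * (\<Prod>i\<in>Poly_Mapping.keys u. (a ! i) ^ Poly_Mapping.lookup u i))"

definition Rn :: "nat \<Rightarrow> 'a::field mpol ring" where
  "Rn n = \<lparr>carrier = {p. \<forall>u\<in>Poly_Mapping.keys p. Poly_Mapping.keys u \<subseteq> {0..n}},
           mult = (*), one = 1, zero = 0, add = (+)\<rparr>"

text \<open>The graded piece $(R_n)_t$; it contains 0.\<close>

definition Rn_comp :: "nat \<Rightarrow> nat \<Rightarrow> 'a::field mpol set" where
  "Rn_comp n t = {p \<in> carrier (Rn n). \<forall>u\<in>Poly_Mapping.keys p. mon_deg u = t}"

definition const_polys :: "'a::field mpol set" where
  "const_polys = range (Poly_Mapping.single 0)"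

text \<open>
  A point of projective $n$-space is an equivalence class of nonzero coordinate lists
  $[a_0, \ldots, a_n]$ up to a nonzero scalar.
\<close>

definition nonzero_coords :: "nat \<Rightarrow> 'a::field list set" where
  "nonzero_coords n = {a. length a = n + 1 \<and> (\<exists>i\<le>n. a ! i \<noteq> 0)}"

definition proj_rel :: "nat \<Rightarrow> ('a::field list \<times> 'a list) set" where
  "proj_rel n = {(a, b). a \<in> nonzero_coords n \<and> b \<in> nonzero_coords n \<and>
                         (\<exists>c. c \<noteq> 0 \<and> b = map ((*) c) a)}"

definition proj_space :: "nat \<Rightarrow> 'a::field list set set" where
  "proj_space n = nonzero_coords n // proj_rel n"

text \<open>
  The embedding $(a_0, \ldots, a_n) \mapsto (a_0, \ldots, a_n, 0, \ldots, 0)$, applied to all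
  representatives of a point; for $P$ in $n$-space the image of the class is again a full class.
\<close>

definition proj_embed :: "nat \<Rightarrow> nat \<Rightarrow> 'a::field list set \<Rightarrow> 'a list set" where
  "proj_embed n m P = (\<lambda>a. a @ replicate (m - n) 0) ` P"

definition point_ideal :: "nat \<Rightarrow> 'a::field list set \<Rightarrow> 'a mpol set" where
  "point_ideal n P =
     genideal (Rn n) {f \<in> (\<Union>t. Rn_comp n t). \<forall>a\<in>P. eval_mpol f a = 0}"

text \<open>
  Powers of ideals are powers in the multiplicative monoid of ideals; nonpositive exponents give
  the unit ideal.
\<close>

definition ideal_pow :: "('r, 'b) ring_scheme \<Rightarrow> 'r set \<Rightarrow> int \<Rightarrow> 'r set" where
  "ideal_pow R I r = (if r \<le> 0 then carrier R else I [^]\<^bsub>ideals_set R\<^esub> nat r)"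

text \<open>
  The ideal $\wp_1^{r_1} \cap \cdots \cap \wp_s^{r_s}$ of $R_n$, with \<open>P i\<close> and \<open>r i\<close>
  used for \<open>i \<in> {1..s}\<close>.  Intersecting with the carrier matters only for the empty
  intersection \<open>s = 0\<close>.
\<close>

definition fat_ideal ::
  "nat \<Rightarrow> nat \<Rightarrow> (nat \<Rightarrow> 'a::field list set) \<Rightarrow> (nat \<Rightarrow> int) \<Rightarrow> 'a mpol set" where
  "fat_ideal n s P r =
     carrier (Rn n) \<inter> (\<Inter>i\<in>{1..s}. ideal_pow (Rn n) (point_ideal n (P i)) (r i))"

text \<open>
  $H_{R_n/I}(t)$ for a homogeneous ideal \<open>I\<close>: the graded piece $(R_n/I)_t$ is the image of
  $(R_n)_t$ in the quotient ring, and the scalars act through the image of the constants.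
  For \<open>I = R_n\<close> the quotient is the zero ring and the dimension is 0.
\<close>

definition hilbert_fun :: "nat \<Rightarrow> 'a::field mpol set \<Rightarrow> nat \<Rightarrow> nat" where
  "hilbert_fun n I t =
     ring.dim (Rn n Quot I)
       ((\<lambda>p. I +>\<^bsub>Rn n\<^esub> p) ` const_polys)
       ((\<lambda>p. I +>\<^bsub>Rn n\<^esub> p) ` Rn_comp n t)"

definition fat_mult :: "nat \<Rightarrow> nat \<Rightarrow> (nat \<Rightarrow> nat) \<Rightarrow> nat" where
  "fat_mult n s \<mu> = (\<Sum>i=1..s. (\<mu> i + n - 1) choose n)"

definition fat_reg :: "nat \<Rightarrow> nat \<Rightarrow> (nat \<Rightarrow> 'a::field list set) \<Rightarrow> (nat \<Rightarrow> nat) \<Rightarrow> nat" where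
  "fat_reg n s P \<mu> =
     (LEAST t. hilbert_fun n (fat_ideal n s P (\<lambda>i. int (\<mu> i))) t = fat_mult n s \<mu>)"

end

theory Submission
  imports Defs
begin

text \<open>
  Write an element of $R_m$ as a sum of $f_v X^v$ over the monomials $X^v$ in $X_{n+1}, \ldots, X_m$,
  with $f_v$ in $R_n$.  The ideal $\mathfrak q$ of an embedded point is generated by $\wp$ and
  $X_{n+1}, \ldots, X_m$, so $f$ lies in $\mathfrak q^r$ iff every $f_v$ lies in $\wp^{r - |v|}$.
  Hence the degree $t$ piece of $I_{\phi(Z)}$ is the direct sum over $v$ of the degree $t - |v|$ pieces
  of $\bigcap_i \wp_i^{m_i - |v|}$, multiplied by $X^v$.  Counting the monomials $X^v$ of each
  degree $t - i$ gives the formula; its term $i = t$ is $H_{R_n/I_Z}(t)$.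
\<close>

text \<open>Membership in a power of the embedded prime can be tested on coefficients for two
  reasons. Forward, the condition that every f_v lies in p^(r - |v|) is multiplicative: f_u g_w
  contributes to the coefficient at u + w, and the exponents add. Backward, X^v itself lies in
  q^|v|. The exponents r - |v| become negative, where the law p^a p^b = p^(a+b) can fail; only the
  inclusion of the left side in the right side survives for all integers, and it suffices. The
  Hilbert function is a dimension inside a quotient ring, over the image of the constants, whereas
  the direct sum lives in a space of polynomials. The bridge is that H(t) and the dimension of the
  degree t piece of the ideal add up to a binomial coefficient. The counting is therefore done for
  ideals, and the differences of a binomial coefficient and a Hilbert value in the formula are
  dimensions of graded pieces of ideals.\<close>

section \<open>Linear algebra: dimension of a direct sum\<close>

context vector_space
begin

text \<open>Coordinates are unique: relative to \<open>D\<close> those of \<open>x\<close> are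
  supported both in \<open>B\<close> and in \<open>D - B\<close>, hence nowhere.\<close>

lemma independent_imp_span_Int_Diff:
  assumes "independent D" "B \<subseteq> D" "x \<in> span B" "x \<in> span (D - B)"
  shows "x = 0"
proof -
  have xD: "x \<in> span D"
    using assms span_mono by blast
  have "representation D x = representation B x" "representation D x = representation (D - B) x"
    using representation_extend[OF assms(1,3,2)] representation_extend[OF assms(1,4)] by auto
  hence "representation D x b = 0" for b
    using representation_ne_zero[of B x b] representation_ne_zero[of "D - B" x b] by fastforce
  thus ?thesis
    using sum_nonzero_representation_eq[OF assms(1) xD] by simp
qed

text \<open>The ambient space is infinite-dimensional and \<open>card\<close> is 0 on infinite sets,
  so finiteness has to come from a finite spanning set.\<close>

lemma finite_basis_of_subspace:
  assumes "subspace V" "V \<subseteq> span F" "finite F"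
  obtains B where "finite B" "independent B" "span B = V" "card B = dim V"
proof -
  obtain B where B: "B \<subseteq> V" "independent B" "V \<subseteq> span B" "card B = dim V"
    using basis_exists by blast
  moreover have "finite B"
    using independent_span_bound[OF assms(3) B(2)] B(1) assms(2) by auto
  moreover have "span B = V"
    using B assms(1) span_minimal by blast
  ultimately show ?thesis
    using that by blast
qed

text \<open>Vectors of \<open>C\<close> are added one at a time. If c = x + y with x in the span of
  \<open>B\<close> and y in that of the earlier part of \<open>C\<close>, then x = c - y lies in
  both spans, so x = 0 and c depends on that earlier part.\<close>

lemma independent_Un_of_trivial_Int:
  assumes "finite C" "independent B" "independent C" "span B \<inter> span C = {0}"
  shows "independent (B \<union> C)"
  using assms
proof (induction C rule: finite_induct)
  case (insert c C)
  have C: "independent C" "c \<notin> span C"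
    using insert.prems(2) insert.hyps(2) by (auto simp: independent_insert)
  have "span C \<subseteq> span (insert c C)"
    by (rule span_mono) auto
  hence 0: "span B \<inter> span C = {0}"
    using insert.prems(3) span_zero by blast
  have "c \<notin> span (B \<union> C)"
  proof
    assume "c \<in> span (B \<union> C)"
    then obtain x y where xy: "c = x + y" "x \<in> span B" "y \<in> span C"
      unfolding span_Un by blast
    have "x = c - y" using xy(1) by simp
    moreover have "c - y \<in> span (insert c C)"
      using xy(3) \<open>span C \<subseteq> span (insert c C)\<close> by (meson insertI1 span_base span_diff subsetD)
    ultimately have "x = 0" using insert.prems(3) xy(2) by blast
    thus False using xy C by simp
  qed
  thus ?case
    using insert.IH[OF insert.prems(1) C(1) 0] by (simp add: independent_insertI)
qed simp

lemma dim_direct_sum: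
  assumes "subspace U" "subspace W" "U \<inter> W = {0}"
    and "U \<subseteq> span F" "finite F" "W \<subseteq> span G" "finite G"
  shows "dim {u + w | u w. u \<in> U \<and> w \<in> W} = dim U + dim W"
proof -
  obtain B where B: "finite B" "independent B" "span B = U" "card B = dim U"
    using finite_basis_of_subspace[OF assms(1,4,5)] by blast
  obtain C where C: "finite C" "independent C" "span C = W" "card C = dim W"
    using finite_basis_of_subspace[OF assms(2,6,7)] by blast
  have "0 \<notin> B"
    using B(2) dependent_zero by blast
  moreover have "B \<inter> C \<subseteq> U \<inter> W"
    using span_superset[of B] span_superset[of C] unfolding B(3) C(3) by blast
  ultimately have "B \<inter> C = {}"
    unfolding assms(3) by blast
  hence "card (B \<union> C) = dim U + dim W"
    using card_Un_disjoint[OF B(1) C(1)] B(4) C(4) by simp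
  moreover have "independent (B \<union> C)"
    using independent_Un_of_trivial_Int[OF C(1) B(2) C(2)] B(3) C(3) assms(3) by simp
  moreover have "span (B \<union> C) = {u + w | u w. u \<in> U \<and> w \<in> W}"
    unfolding span_Un B(3) C(3) by blast
  ultimately show ?thesis
    using dim_span_eq_card_independent[of "B \<union> C"] by simp
qed

end

section \<open>Polynomials as a vector space\<close>

text \<open>Scalars act as constant polynomials, so that this action becomes that of
  \<open>const_polys\<close> in the quotient rings.\<close>

definition scale_mpol :: "'a::field \<Rightarrow> 'a mpol \<Rightarrow> 'a mpol" where
  "scale_mpol c p = Poly_Mapping.single 0 c * p"

interpretation mpol: vector_space scale_mpol
  by unfold_locales
    (simp_all add: scale_mpol_def distrib_left distrib_right single_add mult_single flip: mult.assoc)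

lemma lookup_scale_mpol [simp]:
  "Poly_Mapping.lookup (scale_mpol c p) u = c * Poly_Mapping.lookup p u"
  unfolding scale_mpol_def mult_map_scale_conv_mult[symmetric] by (simp add: Poly_Mapping.map.rep_eq when_def)

lemma scale_mpol_mult_left: "scale_mpol c p * q = scale_mpol c (p * q)"
  by (simp add: scale_mpol_def mult.assoc)

lemma sum_single_keys: "(\<Sum>u\<in>Poly_Mapping.keys p. Poly_Mapping.single u (Poly_Mapping.lookup p u)) = p"
  by (rule poly_mapping_eqI)
    (auto simp: lookup_sum lookup_single when_def in_keys_iff sum.delta)

lemma scale_mpol_single: "scale_mpol c (Poly_Mapping.single u d) = Poly_Mapping.single u (c * d)"
  by (simp add: scale_mpol_def mult_single)

lemma mpol_span_monomials:
  assumes "Poly_Mapping.keys p \<subseteq> A"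
  shows "p \<in> mpol.span ((\<lambda>u. Poly_Mapping.single u 1) ` A)"
proof -
  have "(\<Sum>u\<in>Poly_Mapping.keys p. scale_mpol (Poly_Mapping.lookup p u) (Poly_Mapping.single u 1))
      \<in> mpol.span ((\<lambda>u. Poly_Mapping.single u 1) ` A)"
    using assms by (intro mpol.span_sum mpol.span_scale mpol.span_base) auto
  thus ?thesis
    by (simp add: scale_mpol_single sum_single_keys)
qed

lemma mpol_subspace_keys: "mpol.subspace {p::'a::field mpol. \<forall>u\<in>Poly_Mapping.keys p. u \<in> A}"
proof (rule mpol.subspaceI)
  fix x y :: "'a mpol"
  assume "x \<in> {p. \<forall>u\<in>Poly_Mapping.keys p. u \<in> A}" "y \<in> {p. \<forall>u\<in>Poly_Mapping.keys p. u \<in> A}"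
  thus "x + y \<in> {p. \<forall>u\<in>Poly_Mapping.keys p. u \<in> A}"
    using Poly_Mapping.keys_add[of x y] by blast
qed (auto simp: in_keys_iff)

text \<open>The monomials in \<open>A\<close> form a basis; a linear relation between them is
  refuted by reading off one coefficient.\<close>

lemma mpol_dim_keys:
  assumes "finite A"
  shows "mpol.dim {p::'a::field mpol. \<forall>u\<in>Poly_Mapping.keys p. u \<in> A} = card A"
proof (rule mpol.dim_unique)
  let ?X = "\<lambda>u. Poly_Mapping.single u (1::'a)"
  show "?X ` A \<subseteq> {p. \<forall>u\<in>Poly_Mapping.keys p. u \<in> A}"
    by auto
  show "{p. \<forall>u\<in>Poly_Mapping.keys p. u \<in> A} \<subseteq> mpol.span (?X ` A)"
    using mpol_span_monomials by blast
  have inj: "inj_on ?X A"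
    by (rule inj_onI) (metis keys_single one_neq_zero singleton_inject)
  thus "card (?X ` A) = card A"
    by (rule card_image)
  show "mpol.independent (?X ` A)"
  proof (rule mpol.independent_if_scalars_zero)
    fix f x
    assume 0: "(\<Sum>x\<in>?X ` A. scale_mpol (f x) x) = 0" and "x \<in> ?X ` A"
    then obtain u where u: "u \<in> A" "x = ?X u" by blast
    have "0 = Poly_Mapping.lookup (\<Sum>v\<in>A. scale_mpol (f (?X v)) (?X v)) u"
      using 0 by (simp add: sum.reindex[OF inj])
    also have "\<dots> = f (?X u)"
      using u(1) assms by (simp add: lookup_sum lookup_single when_def if_distrib cong: if_cong)
    finally show "f x = 0" using u by simp
  qed (use assms in simp)
qed

section \<open>Counting monomials of a given degree\<close>

lemma mon_deg_eq_sum: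
  assumes "finite A" "Poly_Mapping.keys u \<subseteq> A"
  shows "mon_deg u = (\<Sum>i\<in>A. Poly_Mapping.lookup u i)"
  unfolding mon_deg_def using assms by (intro sum.mono_neutral_left) (auto simp: in_keys_iff)

text \<open>Equality, and not just an inclusion, because natural exponents cannot cancel.\<close>

lemma keys_add_nat: "Poly_Mapping.keys (u + v) = Poly_Mapping.keys u \<union> Poly_Mapping.keys v"
  for u v :: "nat \<Rightarrow>\<^sub>0 nat"
  by (auto simp: in_keys_iff lookup_add)

lemma mon_deg_add: "mon_deg (u + v) = mon_deg u + mon_deg v"
proof -
  let ?A = "Poly_Mapping.keys u \<union> Poly_Mapping.keys v"
  show ?thesis
    using mon_deg_eq_sum[of ?A] by (simp add: keys_add_nat lookup_add sum.distrib)
qed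

lemma mon_deg_0 [simp]: "mon_deg 0 = 0"
  by (simp add: mon_deg_def)

definition monomials :: "nat set \<Rightarrow> nat \<Rightarrow> (nat \<Rightarrow>\<^sub>0 nat) set" where
  "monomials A t = {u. Poly_Mapping.keys u \<subseteq> A \<and> mon_deg u = t}"

text \<open>A monomial in k consecutive variables is its list of exponents, which turns the count
  into the known number of lists with given length and sum. The offset \<open>a\<close> serves both
  X_0, ..., X_n and X_{n+1}, ..., X_m.\<close>

lemma bij_betw_monomials_lists:
  "bij_betw (\<lambda>u. map (Poly_Mapping.lookup u) [a..<a + k]) (monomials {a..<a + k} t)
     {l. length l = k \<and> sum_list l = t}"
proof (rule bij_betwI')
  fix u v assume uv: "u \<in> monomials {a..<a + k} t" "v \<in> monomials {a..<a + k} t"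
  show "(map (Poly_Mapping.lookup u) [a..<a + k] = map (Poly_Mapping.lookup v) [a..<a + k]) = (u = v)"
  proof
    assume eq: "map (Poly_Mapping.lookup u) [a..<a + k] = map (Poly_Mapping.lookup v) [a..<a + k]"
    show "u = v"
    proof (rule poly_mapping_eqI)
      fix i
      show "Poly_Mapping.lookup u i = Poly_Mapping.lookup v i"
      proof (cases "i \<in> {a..<a + k}")
        case False
        hence "i \<notin> Poly_Mapping.keys u" "i \<notin> Poly_Mapping.keys v"
          using uv unfolding monomials_def by blast+
        thus ?thesis by (simp add: in_keys_iff)
      qed (use eq in auto)
    qed
  qed simp
next
  fix u assume "u \<in> monomials {a..<a + k} t"
  thus "map (Poly_Mapping.lookup u) [a..<a + k] \<in> {l. length l = k \<and> sum_list l = t}"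
    using mon_deg_eq_sum[of "{a..<a + k}" u]
    by (simp add: monomials_def sum_list_distinct_conv_sum_set)
next
  fix l :: "nat list" assume l: "l \<in> {l. length l = k \<and> sum_list l = t}"
  \<comment> \<open>The preimage of \<open>l\<close> has its entries as exponents on the window and
    exponent 0 elsewhere.\<close>
  define f where "f = (\<lambda>i. if i \<in> {a..<a + k} then l ! (i - a) else 0)"
  have fin: "finite {i. f i \<noteq> 0}"
    by (rule finite_subset[of _ "{a..<a + k}"]) (auto simp: f_def)
  define u where "u = Abs_poly_mapping f"
  have u: "Poly_Mapping.lookup u = f"
    using fin by (simp add: u_def)
  have keys: "Poly_Mapping.keys u \<subseteq> {a..<a + k}"
    by (auto simp: in_keys_iff u f_def split: if_splits)
  have map: "l = map (Poly_Mapping.lookup u) [a..<a + k]"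
    using l by (intro nth_equalityI) (simp_all add: u f_def)
  have "mon_deg u = sum_list l"
    using mon_deg_eq_sum[OF _ keys] by (subst map) (simp add: sum_list_distinct_conv_sum_set)
  thus "\<exists>u\<in>monomials {a..<a + k} t. l = map (Poly_Mapping.lookup u) [a..<a + k]"
    using map keys l unfolding monomials_def by blast
qed

lemma card_monomials: "card (monomials {a..<a + k} t) = (t + k - 1) choose t"
  using bij_betw_same_card[OF bij_betw_monomials_lists] card_length_sum_list[of k t] by simp

lemma finite_monomials:
  assumes "finite A"
  shows "finite (monomials A t)"
proof -
  obtain k where k: "A \<subseteq> {0..<0 + k}"
    using assms finite_nat_iff_bounded by (metis add_0 atLeast0LessThan)
  have "set l \<subseteq> {..t}" if "sum_list l = t" for l
    using that member_le_sum_list[of _ l] by auto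
  hence "{l. length l = k \<and> sum_list l = t} \<subseteq> {l. set l \<subseteq> {..t} \<and> length l = k}"
    by blast
  hence "finite {l. length l = k \<and> sum_list l = t}"
    by (rule finite_subset) (simp add: finite_lists_length_eq)
  hence "finite (monomials {0..<0 + k} t)"
    using bij_betw_finite[OF bij_betw_monomials_lists] by metis
  moreover have "monomials A t \<subseteq> monomials {0..<0 + k} t"
    using k by (auto simp: monomials_def)
  ultimately show ?thesis
    by (rule rev_finite_subset)
qed

section \<open>The rings R_n and the Hilbert function as a codimension\<close>

lemma carrier_Rn:
  "carrier (Rn n) = {p. \<forall>u\<in>Poly_Mapping.keys p. Poly_Mapping.keys u \<subseteq> {0..n}}"
  by (simp add: Rn_def)

lemma Rn_simps [simp]:
  "x \<otimes>\<^bsub>Rn n\<^esub> y = x * y" "\<one>\<^bsub>Rn n\<^esub> = 1" "\<zero>\<^bsub>Rn n\<^esub> = 0" "x \<oplus>\<^bsub>Rn n\<^esub> y = x + y"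
  by (simp_all add: Rn_def)

lemma Rn_comp_eq: "Rn_comp n t = {p. \<forall>u\<in>Poly_Mapping.keys p. u \<in> monomials {0..n} t}"
  by (auto simp: Rn_comp_def monomials_def carrier_Rn)

lemma mpol_subspace_Rn: "mpol.subspace (carrier (Rn n))"
  using mpol_subspace_keys[of "{u. Poly_Mapping.keys u \<subseteq> {0..n}}"] by (simp add: carrier_Rn)

lemma mpol_subspace_Rn_comp: "mpol.subspace (Rn_comp n t)"
  unfolding Rn_comp_eq by (rule mpol_subspace_keys)

lemma Rn_mult_closed: "\<lbrakk>p \<in> carrier (Rn n); q \<in> carrier (Rn n)\<rbrakk> \<Longrightarrow> p * q \<in> carrier (Rn n)"
  using keys_mult[of p q] by (fastforce simp: keys_add_nat carrier_Rn)

lemma const_polys_subset_Rn: "const_polys \<subseteq> carrier (Rn n)"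
  by (auto simp: const_polys_def carrier_Rn in_keys_iff lookup_single when_def split: if_splits)

lemma zero_one_in_Rn: "0 \<in> carrier (Rn n)" "1 \<in> carrier (Rn n)"
  by (simp_all add: carrier_Rn)

lemma cring_Rn: "cring (Rn n :: 'a::field mpol ring)"
proof (rule cringI)
  show "abelian_group (Rn n :: 'a mpol ring)"
  proof (rule abelian_groupI)
    fix x :: "'a mpol" assume "x \<in> carrier (Rn n)"
    thus "\<exists>y\<in>carrier (Rn n). y \<oplus>\<^bsub>Rn n\<^esub> x = \<zero>\<^bsub>Rn n\<^esub>"
      using mpol.subspace_neg[OF mpol_subspace_Rn] by (intro bexI[of _ "- x"]) auto
  qed (use mpol.subspace_add[OF mpol_subspace_Rn[of n, where 'a = 'a]] zero_one_in_Rn in \<open>auto simp: add_ac\<close>)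
  show "comm_monoid (Rn n :: 'a mpol ring)"
    by (rule comm_monoidI) (use Rn_mult_closed[where n = n and 'a = 'a] zero_one_in_Rn in \<open>auto simp: mult_ac\<close>)
qed (simp add: distrib_right)

lemma Rn_uminus:
  assumes "p \<in> carrier (Rn n)"
  shows "\<ominus>\<^bsub>Rn n\<^esub> p = - p"
proof -
  interpret R: cring "Rn n" by (rule cring_Rn)
  show ?thesis
    using assms mpol.subspace_neg[OF mpol_subspace_Rn assms] by (intro R.minus_equality) auto
qed

lemma Rn_minus:
  "\<lbrakk>p \<in> carrier (Rn n); q \<in> carrier (Rn n)\<rbrakk> \<Longrightarrow> p \<ominus>\<^bsub>Rn n\<^esub> q = p - q"
  by (simp add: a_minus_def Rn_uminus)

text \<open>Uniqueness of the dimension in \<open>HOL-Algebra\<close> requires scalars that form a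
  subfield; the image of this one in a nonzero quotient is again a subfield.\<close>

lemma subfield_const_polys: "subfield const_polys (Rn n :: 'a::field mpol ring)"
proof -
  interpret R: cring "Rn n :: 'a mpol ring" by (rule cring_Rn)
  show ?thesis
  proof (rule R.subfieldI[OF R.subcringI'])
    show "subring const_polys (Rn n :: 'a mpol ring)"
    proof (rule R.subringI)
      show "\<ominus>\<^bsub>Rn n\<^esub> h \<in> const_polys" if "h \<in> const_polys" for h :: "'a mpol"
      proof -
        have "\<ominus>\<^bsub>Rn n\<^esub> h = - h"
          using that const_polys_subset_Rn by (intro Rn_uminus) blast
        thus ?thesis
          using that by (auto simp: const_polys_def simp flip: single_uminus)
      qed
      show "\<one>\<^bsub>Rn n\<^esub> \<in> (const_polys :: 'a mpol set)"
        unfolding const_polys_def Rn_simps single_one[symmetric] by blast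
    qed (use const_polys_subset_Rn in \<open>auto simp: const_polys_def mult_single simp flip: single_add\<close>)
  next
    show "Units (Rn n\<lparr>carrier := const_polys\<rparr>) = (const_polys :: 'a mpol set) - {\<zero>\<^bsub>Rn n\<^esub>}"
      (is "?U = _")
    proof
      show "?U \<subseteq> const_polys - {\<zero>\<^bsub>Rn n\<^esub>}"
        by (auto simp: Units_def)
      show "const_polys - {\<zero>\<^bsub>Rn n\<^esub>} \<subseteq> ?U"
      proof
        fix k :: "'a mpol" assume "k \<in> const_polys - {\<zero>\<^bsub>Rn n\<^esub>}"
        then obtain c where "k = Poly_Mapping.single 0 c" "k \<noteq> 0"
          by (auto simp: const_polys_def)
        moreover from this have "c \<noteq> 0" by auto
        ultimately show "k \<in> ?U"
          by (auto simp: Units_def const_polys_def mult_single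
              intro!: exI[of _ "inverse c"])
      qed
    qed
  qed
qed

lemma mpol_subspace_ideal:
  assumes "ideal I (Rn n)"
  shows "mpol.subspace I"
proof (rule mpol.subspaceI)
  interpret ideal I "Rn n" by fact
  show "0 \<in> I" using additive_subgroup.zero_closed[OF is_additive_subgroup] by simp
  show "x + y \<in> I" if "x \<in> I" "y \<in> I" for x y 
    using additive_subgroup.a_closed[OF is_additive_subgroup that] by simp
  show "scale_mpol c x \<in> I" if "x \<in> I" for c x
    using I_l_closed[OF that, of "Poly_Mapping.single 0 c"] const_polys_subset_Rn
    by (auto simp: scale_mpol_def const_polys_def)
qed

text \<open>In the zero ring the image of the constants is no field, so \<open>dim\<close> must be
  evaluated from its definition. No line extension is possible: it would need a vector outside
  {0}.\<close>

lemma (in ring) dim_zero_ring: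
  assumes "carrier R = {\<zero>}"
  shows "dim K {\<zero>} = 0"
proof -
  have "n = 0 \<and> E = {\<zero>}" if "dimension n K E" for n E
    using that assms by (induction rule: dimension.induct) auto
  thus ?thesis
    unfolding dim_def by (intro the_equality) (auto simp: zero_dim)
qed

text \<open>Translates a basis of polynomials into the inductive \<open>dimension\<close> of the
  quotient ring. Since the span of \<open>C\<close> meets \<open>I\<close> only in 0, the projection
  is injective on that span, and each new basis vector gives a proper line extension.\<close>

lemma Rn_dimension_quotient_span:
  fixes I :: "'a::field mpol set"
  assumes "ideal I (Rn n)" "finite C" "C \<subseteq> carrier (Rn n)" "mpol.independent C"
    and "mpol.span C \<inter> I \<subseteq> {0}"
  shows "ring.dimension (Rn n Quot I) (card C) ((\<lambda>p. I +>\<^bsub>Rn n\<^esub> p) ` const_polys)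
    ((\<lambda>p. I +>\<^bsub>Rn n\<^esub> p) ` mpol.span C)"
proof -
  interpret I: ideal I "Rn n" by fact
  interpret Q: ring "Rn n Quot I" by (rule I.quotient_is_ring)
  interpret h: ring_hom_ring "Rn n" "Rn n Quot I" "\<lambda>p. I +>\<^bsub>Rn n\<^esub> p"
    by (rule I.rcos_ring_hom_ring)
  let ?\<pi> = "\<lambda>p. I +>\<^bsub>Rn n\<^esub> p"
  show ?thesis
    using assms(2-)
  proof (induction C rule: finite_induct)
    case empty
    show ?case using Q.zero_dim h.hom_zero by simp
  next
    case (insert c C)
    have C: "mpol.independent C" "c \<notin> mpol.span C"
      using insert.prems(2) insert.hyps(2) by (auto simp: mpol.independent_insert)
    have sub: "mpol.span C \<subseteq> mpol.span (insert c C)"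
      by (rule mpol.span_mono) auto
    have carr: "mpol.span (insert c C) \<subseteq> carrier (Rn n)"
      by (rule mpol.span_minimal[OF insert.prems(1) mpol_subspace_Rn])
    have c: "c \<in> carrier (Rn n)"
      using insert.prems(1) by blast
    have "Q.dimension (card C) (?\<pi> ` const_polys) (?\<pi> ` mpol.span C)"
      using insert.IH insert.prems C(1) sub by blast
    \<comment> \<open>If the class of \<open>c\<close> were that of some \<open>x\<close> in the
      span, then c - x would lie in \<open>I\<close> and in the span of \<open>insert c C\<close>,
      hence be 0.\<close>
    moreover have "?\<pi> c \<notin> ?\<pi> ` mpol.span C"
    proof
      assume "?\<pi> c \<in> ?\<pi> ` mpol.span C"
      then obtain x where x: "x \<in> mpol.span C" "?\<pi> c = ?\<pi> x" by blast
      have "x \<in> carrier (Rn n)" using x(1) sub carr by blast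
      hence "c \<ominus>\<^bsub>Rn n\<^esub> x \<in> I"
        using x(2) c I.quotient_eq_iff_same_a_r_cos[OF assms(1)] by blast
      moreover have "c \<ominus>\<^bsub>Rn n\<^esub> x = c - x"
        using c \<open>x \<in> carrier (Rn n)\<close> by (rule Rn_minus)
      ultimately have "c - x \<in> I" by simp
      moreover have "c - x \<in> mpol.span (insert c C)"
        using x(1) sub by (meson insertI1 mpol.span_base mpol.span_diff subsetD)
      ultimately have "c - x = 0" using insert.prems(3) by blast
      thus False using x C(2) by simp
    qed
    moreover have "Q.line_extension (?\<pi> ` const_polys) (?\<pi> c) (?\<pi> ` mpol.span C)
        = ?\<pi> ` mpol.span (insert c C)"
    proof -
      have hom: "?\<pi> k \<otimes>\<^bsub>Rn n Quot I\<^esub> ?\<pi> c \<oplus>\<^bsub>Rn n Quot I\<^esub> ?\<pi> x = ?\<pi> (k * c + x)"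
        if "k \<in> const_polys" "x \<in> mpol.span C" for k x
      proof -
        have "k \<in> carrier (Rn n)" "x \<in> carrier (Rn n)"
          using that const_polys_subset_Rn sub carr by blast+
        thus ?thesis
          using c h.hom_mult[of k c] h.hom_add[of "k * c" x] Rn_mult_closed[of k n c] by simp
      qed
      \<comment> \<open>This is \<open>mpol.span_breakdown_eq\<close> in the shape of a line
        extension before projection.\<close>
      have ins: "z \<in> mpol.span (insert c C) \<longleftrightarrow> (\<exists>k\<in>const_polys. \<exists>x\<in>mpol.span C. z = k * c + x)" for z
      proof
        assume "z \<in> mpol.span (insert c C)"
        then obtain k where "z - scale_mpol k c \<in> mpol.span C"
          unfolding mpol.span_breakdown_eq by blast
        moreover have "z = Poly_Mapping.single 0 k * c + (z - scale_mpol k c)"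
          by (simp add: scale_mpol_def)
        ultimately show "\<exists>k\<in>const_polys. \<exists>x\<in>mpol.span C. z = k * c + x"
          unfolding const_polys_def by blast
      next
        assume "\<exists>k\<in>const_polys. \<exists>x\<in>mpol.span C. z = k * c + x"
        then obtain k x where "x \<in> mpol.span C" "z = scale_mpol k c + x"
          unfolding const_polys_def scale_mpol_def by blast
        hence "z - scale_mpol k c \<in> mpol.span C" by simp
        thus "z \<in> mpol.span (insert c C)"
          unfolding mpol.span_breakdown_eq by blast
      qed
      show ?thesis
      proof (rule Set.set_eqI)
        fix y
        have "y \<in> Q.line_extension (?\<pi> ` const_polys) (?\<pi> c) (?\<pi> ` mpol.span C) \<longleftrightarrow>
            (\<exists>k\<in>const_polys. \<exists>x\<in>mpol.span C. y = ?\<pi> k \<otimes>\<^bsub>Rn n Quot I\<^esub> ?\<pi> c \<oplus>\<^bsub>Rn n Quot I\<^esub> ?\<pi> x)"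
          unfolding Q.line_extension_mem_iff bex_simps ..
        also have "\<dots> \<longleftrightarrow> (\<exists>k\<in>const_polys. \<exists>x\<in>mpol.span C. y = ?\<pi> (k * c + x))"
          by (intro bex_cong refl) (simp only: hom)
        also have "\<dots> \<longleftrightarrow> y \<in> ?\<pi> ` mpol.span (insert c C)"
          unfolding image_iff Bex_def ins by blast
        finally show "y \<in> Q.line_extension (?\<pi> ` const_polys) (?\<pi> c) (?\<pi> ` mpol.span C) \<longleftrightarrow>
            y \<in> ?\<pi> ` mpol.span (insert c C)" .
      qed
    qed
    ultimately show ?case
      using Q.Suc_dim[OF h.hom_closed[OF c]] insert.hyps by (metis card_insert_disjoint)
  qed
qed

lemma Rn_comp_subset_span:
  "Rn_comp n t \<subseteq> mpol.span ((\<lambda>u. Poly_Mapping.single u 1) ` monomials {0..n} t)"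
  unfolding Rn_comp_eq using mpol_span_monomials by blast

lemma dim_Rn_comp: "mpol.dim (Rn_comp n t) = (t + n) choose n"
  using card_monomials[of 0 "n + 1" t] binomial_symmetric[of n "t + n"]
  unfolding Rn_comp_eq
  by (subst mpol_dim_keys) (simp_all add: finite_monomials atLeastLessThanSuc_atLeastAtMost)

text \<open>Rank-nullity for the projection of (R_n)_t to the quotient: a basis \<open>B\<close> of
  the kernel extends to a basis \<open>D\<close> of (R_n)_t, and the classes of \<open>D - B\<close>
  form a basis of the image. The sum form avoids truncated subtraction.\<close>

lemma hilbert_fun_add_dim:
  fixes I :: "'a::field mpol set"
  assumes "ideal I (Rn n)"
  shows "hilbert_fun n I t + mpol.dim (Rn_comp n t \<inter> I) = (t + n) choose n"
proof -
  interpret I: ideal I "Rn n" by fact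
  interpret Q: ring "Rn n Quot I" by (rule I.quotient_is_ring)
  interpret h: ring_hom_ring "Rn n" "Rn n Quot I" "\<lambda>p. I +>\<^bsub>Rn n\<^esub> p"
    by (rule I.rcos_ring_hom_ring)
  let ?\<pi> = "\<lambda>p. I +>\<^bsub>Rn n\<^esub> p"
  let ?V = "Rn_comp n t :: 'a mpol set"
  have subI: "subgroup I (add_monoid (Rn n))"
    by (rule additive_subgroup.a_subgroup[OF I.is_additive_subgroup])
  have VR: "?V \<subseteq> carrier (Rn n)"
    by (auto simp: Rn_comp_def)
  have \<pi>_I: "?\<pi> x = \<zero>\<^bsub>Rn n Quot I\<^esub>" if "x \<in> I" for x
    using I.a_coset_join2[OF _ subI that] I.Icarr[OF that] by (simp add: FactRing_def)
  show ?thesis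
  proof (cases "1 \<in> I")
    \<comment> \<open>The unit ideal is separate because the quotient is then the zero ring, whose
      scalars do not form a field.\<close>
    case True
    hence I: "I = carrier (Rn n)"
      using I.one_imp_carrier by simp
    have "carrier (Rn n Quot I) = {\<zero>\<^bsub>Rn n Quot I\<^esub>}"
      using \<pi>_I I.Icarr unfolding FactRing_def A_RCOSETS_def' I by force
    moreover have "?\<pi> ` ?V = {\<zero>\<^bsub>Rn n Quot I\<^esub>}"
      using \<pi>_I VR mpol.subspace_0[OF mpol_subspace_Rn_comp[of n t, where 'a = 'a]] unfolding I by blast
    ultimately have "hilbert_fun n I t = 0"
      unfolding hilbert_fun_def by (simp add: Q.dim_zero_ring)
    moreover have "?V \<inter> I = ?V"
      using VR I by blast
    ultimately show ?thesis
      by (simp add: dim_Rn_comp)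
  next
    case False
    have sub: "mpol.subspace (?V \<inter> I)"
      by (intro mpol.subspace_inter mpol_subspace_Rn_comp mpol_subspace_ideal[OF assms])
    obtain B where B: "B \<subseteq> ?V \<inter> I" "mpol.independent B" "?V \<inter> I \<subseteq> mpol.span B"
      using mpol.maximal_independent_subset by blast
    then obtain D where D: "B \<subseteq> D" "D \<subseteq> ?V" "mpol.independent D" "?V \<subseteq> mpol.span D"
      using mpol.maximal_independent_subset_extend[of B ?V] by blast
    have "finite D"
      using mpol.independent_span_bound[OF _ D(3)] D(2) Rn_comp_subset_span[of n t]
      by (meson finite_atLeastAtMost finite_imageI finite_monomials subset_trans)
    have spanD: "mpol.span D = ?V"
      using mpol.span_minimal[OF D(2) mpol_subspace_Rn_comp] D(4) by blast
    have spanB: "mpol.span B = ?V \<inter> I"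
      using mpol.span_minimal[OF B(1) sub] B(3) by blast
    \<comment> \<open>Such an \<open>x\<close> lies in (R_n)_t and in \<open>I\<close>, hence in the
      span of \<open>B\<close>; two complementary parts of a basis share only 0.\<close>
    have "x = 0" if "x \<in> mpol.span (D - B)" "x \<in> I" for x
    proof -
      have "x \<in> mpol.span D"
        using that(1) mpol.span_mono[of "D - B" D] by blast
      hence "x \<in> mpol.span B"
        using that(2) spanB spanD by blast
      thus ?thesis
        using mpol.independent_imp_span_Int_Diff[OF D(3,1)] that(1) by blast
    qed
    hence "mpol.span (D - B) \<inter> I \<subseteq> {0}" by blast
    moreover have "mpol.independent (D - B)"
      using D(3) by (rule mpol.independent_mono) blast
    ultimately have "Q.dimension (card (D - B)) (?\<pi> ` const_polys) (?\<pi> ` mpol.span (D - B))"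
      using \<open>finite D\<close> D(2) VR by (intro Rn_dimension_quotient_span assms) auto
    moreover have "?\<pi> ` mpol.span (D - B) = ?\<pi> ` ?V"
    proof
      show "?\<pi> ` mpol.span (D - B) \<subseteq> ?\<pi> ` ?V"
        unfolding spanD[symmetric] by (intro image_mono mpol.span_mono) blast
      show "?\<pi> ` ?V \<subseteq> ?\<pi> ` mpol.span (D - B)"
      proof
        fix y assume "y \<in> ?\<pi> ` ?V"
        then obtain z where z: "y = ?\<pi> z" "z \<in> ?V" by blast
        have "D = B \<union> (D - B)" using D(1) by blast
        hence "mpol.span D = {x + y | x y. x \<in> mpol.span B \<and> y \<in> mpol.span (D - B)}"
          using mpol.span_Un[of B "D - B"] by simp
        then obtain b c where bc: "z = b + c" "b \<in> mpol.span B" "c \<in> mpol.span (D - B)"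
          using z(2) unfolding spanD by blast
        have "c \<in> mpol.span D"
          using bc(3) mpol.span_mono[of "D - B" D] by blast
        hence "b \<in> carrier (Rn n)" "c \<in> carrier (Rn n)" "b \<in> I"
          using bc(2) VR unfolding spanB spanD by blast+
        hence "?\<pi> z = ?\<pi> c"
          using h.hom_add[of b c] \<pi>_I[of b] bc(1) by simp
        thus "y \<in> ?\<pi> ` mpol.span (D - B)"
          using z(1) bc(3) by blast
      qed
    qed
    moreover have "subfield (?\<pi> ` const_polys) (Rn n Quot I)"
    proof (rule h.img_is_subfield(2)[OF subfield_const_polys])
      show "\<one>\<^bsub>Rn n Quot I\<^esub> \<noteq> \<zero>\<^bsub>Rn n Quot I\<^esub>"
        using False I.a_coset_join1[OF _ _ subI, of 1] zero_one_in_Rn(2) by (auto simp: FactRing_def)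
    qed
    ultimately have "hilbert_fun n I t = card (D - B)"
      using Q.dimI unfolding hilbert_fun_def over_def by metis
    also have "\<dots> = card D - card B"
      using \<open>finite D\<close> D(1) by (intro card_Diff_subset) (auto intro: finite_subset)
    finally have "hilbert_fun n I t = card D - card B" .
    moreover have "card B \<le> card D"
      using \<open>finite D\<close> D(1) by (intro card_mono) auto
    moreover have "card D = (t + n) choose n"
      using mpol.dim_span_eq_card_independent[OF D(3)] unfolding spanD dim_Rn_comp by simp
    moreover have "card B = mpol.dim (?V \<inter> I)"
      using mpol.dim_span_eq_card_independent[OF B(2)] unfolding spanB by simp
    ultimately show ?thesis by simp
  qed
qed

section \<open>Slices: coefficients with respect to the variables beyond X_n\<close>

definition mon_part :: "nat set \<Rightarrow> (nat \<Rightarrow>\<^sub>0 nat) \<Rightarrow> (nat \<Rightarrow>\<^sub>0 nat)" where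
  "mon_part A u = Abs_poly_mapping (\<lambda>i. Poly_Mapping.lookup u i when i \<in> A)"

lemma lookup_mon_part: "Poly_Mapping.lookup (mon_part A u) i = (Poly_Mapping.lookup u i when i \<in> A)"
proof -
  have "finite {i. (Poly_Mapping.lookup u i when i \<in> A) \<noteq> 0}"
    by (rule finite_subset[of _ "Poly_Mapping.keys u"]) (auto simp: in_keys_iff when_def)
  thus ?thesis by (simp add: mon_part_def)
qed

lemma keys_mon_part: "Poly_Mapping.keys (mon_part A u) = Poly_Mapping.keys u \<inter> A"
  by (auto simp: in_keys_iff lookup_mon_part when_def split: if_splits)

text \<open>Unique factorisation of a monomial along a partition of the variables. As an equivalence
  it rewrites the side conditions in \<open>slice\<close> into equations.\<close>

lemma mon_part_add_eq_iff:
  assumes "A \<inter> B = {}" "A \<union> B = UNIV"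
  shows "u = w + v \<and> Poly_Mapping.keys w \<subseteq> A \<and> Poly_Mapping.keys v \<subseteq> B \<longleftrightarrow> w = mon_part A u \<and> v = mon_part B u"
proof
  assume *: "u = w + v \<and> Poly_Mapping.keys w \<subseteq> A \<and> Poly_Mapping.keys v \<subseteq> B"
  hence "Poly_Mapping.lookup w i = 0 \<or> i \<in> A" "Poly_Mapping.lookup v i = 0 \<or> i \<in> B" for i
    by (auto simp: in_keys_iff)
  thus "w = mon_part A u \<and> v = mon_part B u"
    using assms * by (intro conjI poly_mapping_eqI) (auto simp: lookup_mon_part lookup_add when_def)
next
  assume "w = mon_part A u \<and> v = mon_part B u"
  moreover have "u = mon_part A u + mon_part B u"
    using assms by (intro poly_mapping_eqI) (auto simp: lookup_mon_part lookup_add when_def)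
  ultimately show "u = w + v \<and> Poly_Mapping.keys w \<subseteq> A \<and> Poly_Mapping.keys v \<subseteq> B"
    by (simp add: keys_mon_part)
qed

text \<open>
  The coefficient in $R_n$ of the monomial \<open>v\<close> in the variables $X_{n+1}, X_{n+2}, \ldots$;
  it is 0 when \<open>v\<close> involves other variables.
\<close>

definition slice :: "nat \<Rightarrow> (nat \<Rightarrow>\<^sub>0 nat) \<Rightarrow> 'a::field mpol \<Rightarrow> 'a mpol" where
  "slice n v f = Abs_poly_mapping
     (\<lambda>w. Poly_Mapping.lookup f (w + v) when Poly_Mapping.keys w \<subseteq> {0..n} \<and> Poly_Mapping.keys v \<subseteq> {n<..})"

lemma lookup_slice:
  "Poly_Mapping.lookup (slice n v f) w =
    (Poly_Mapping.lookup f (w + v) when Poly_Mapping.keys w \<subseteq> {0..n} \<and> Poly_Mapping.keys v \<subseteq> {n<..})"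
proof -
  \<comment> \<open>Translation by \<open>v\<close> is injective, so the support stays finite and
    \<open>Abs_poly_mapping\<close> can be evaluated.\<close>
  have "finite ((\<lambda>w. w + v) -` Poly_Mapping.keys f)"
    by (intro finite_vimageI) (simp_all add: inj_def)
  hence "finite {w. (Poly_Mapping.lookup f (w + v) when
      Poly_Mapping.keys w \<subseteq> {0..n} \<and> Poly_Mapping.keys v \<subseteq> {n<..}) \<noteq> 0}"
    by (rule rev_finite_subset) (auto simp: in_keys_iff when_def split: if_splits)
  thus ?thesis by (simp add: slice_def)
qed

lemma slice_add: "slice n v (f + g) = slice n v f + slice n v g"
  by (rule poly_mapping_eqI) (simp add: lookup_slice lookup_add when_def)

lemma slice_0 [simp]: "slice n v 0 = 0"
  by (rule poly_mapping_eqI) (simp add: lookup_slice)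

lemma slice_sum: "slice n v (\<Sum>x\<in>A. f x) = (\<Sum>x\<in>A. slice n v (f x))"
  by (induction A rule: infinite_finite_induct) (simp_all add: slice_add)

lemma slice_in_Rn: "slice n v f \<in> carrier (Rn n)"
proof -
  have "Poly_Mapping.keys u \<subseteq> {0..n}" if "u \<in> Poly_Mapping.keys (slice n v f)" for u
    using that by (simp add: in_keys_iff[of u] lookup_slice when_def split: if_splits)
  thus ?thesis by (simp add: carrier_Rn)
qed

lemma slice_single:
  "slice n v (Poly_Mapping.single u c) =
    (if v = mon_part {n<..} u then Poly_Mapping.single (mon_part {0..n} u) c else 0)"
proof (rule poly_mapping_eqI)
  fix w
  have "{0..n} \<inter> {n<..} = {}" "{0..n} \<union> {n<..} = UNIV"
    by auto
  from mon_part_add_eq_iff[OF this, of u w v]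
  show "Poly_Mapping.lookup (slice n v (Poly_Mapping.single u c)) w = Poly_Mapping.lookup
      (if v = mon_part {n<..} u then Poly_Mapping.single (mon_part {0..n} u) c else 0) w"
    by (auto simp: lookup_slice lookup_single when_def)
qed

lemma slice_eq_sum:
  "slice n v f = (\<Sum>u\<in>Poly_Mapping.keys f. if v = mon_part {n<..} u
     then Poly_Mapping.single (mon_part {0..n} u) (Poly_Mapping.lookup f u) else 0)"
  by (subst sum_single_keys[of f, symmetric]) (simp add: slice_sum slice_single)

text \<open>Each term of \<open>f\<close> occurs in exactly one slice, that of its high part, and
  multiplication by the high part restores it. Together with \<open>slice_mult_single\<close> this
  makes the X^v a free basis over R_n with the slices as coordinates.\<close>

lemma sum_slices:
  assumes "finite V" "mon_part {n<..} ` Poly_Mapping.keys f \<subseteq> V"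
  shows "(\<Sum>v\<in>V. slice n v f * Poly_Mapping.single v 1) = f"
proof -
  let ?c = "Poly_Mapping.lookup f"
  have split: "mon_part {0..n} u + mon_part {n<..} u = u" for u
    by (rule poly_mapping_eqI) (auto simp: lookup_mon_part lookup_add when_def)
  have "(\<Sum>v\<in>V. slice n v f * Poly_Mapping.single v 1) =
      (\<Sum>v\<in>V. \<Sum>u\<in>Poly_Mapping.keys f. if v = mon_part {n<..} u then Poly_Mapping.single u (?c u) else 0)"
    unfolding slice_eq_sum[of n _ f] sum_distrib_right
    by (intro sum.cong refl) (simp add: mult_single split)
  also have "\<dots> = (\<Sum>u\<in>Poly_Mapping.keys f. Poly_Mapping.single u (?c u))"
    using assms by (subst sum.swap) (intro sum.cong refl, auto simp: sum.delta)
  finally show ?thesis by (simp add: sum_single_keys)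
qed

lemma slice_mult_single:
  assumes "h \<in> carrier (Rn n)" "Poly_Mapping.keys w \<subseteq> {n<..}"
  shows "slice n v (h * Poly_Mapping.single w 1) = (if v = w then h else 0)"
proof -
  have "h * Poly_Mapping.single w 1 =
      (\<Sum>u\<in>Poly_Mapping.keys h. Poly_Mapping.single (u + w) (Poly_Mapping.lookup h u))"
    by (subst sum_single_keys[of h, symmetric]) (simp only: sum_distrib_right mult_single mult_1_right)
  hence "slice n v (h * Poly_Mapping.single w 1) =
      (\<Sum>u\<in>Poly_Mapping.keys h. if v = w then Poly_Mapping.single u (Poly_Mapping.lookup h u) else 0)"
  proof (simp only: slice_sum, intro sum.cong refl)
    fix u assume "u \<in> Poly_Mapping.keys h"
    hence "Poly_Mapping.keys u \<subseteq> {0..n}"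
      using assms(1) by (auto simp: carrier_Rn)
    hence "u = mon_part {0..n} (u + w) \<and> w = mon_part {n<..} (u + w)"
      using assms(2) by (subst mon_part_add_eq_iff[symmetric]) auto
    thus "slice n v (Poly_Mapping.single (u + w) (Poly_Mapping.lookup h u)) =
        (if v = w then Poly_Mapping.single u (Poly_Mapping.lookup h u) else 0)"
      unfolding slice_single by metis
  qed
  thus ?thesis
    using sum_single_keys[of h] by simp
qed

lemma slice_0_Rn: "h \<in> carrier (Rn n) \<Longrightarrow> slice n 0 h = h"
  using slice_mult_single[of h n 0 0] by simp

section \<open>Powers of ideals with integer exponents\<close>

context cring
begin

lemma ideal_ideal_pow:
  assumes "ideal I R"
  shows "ideal (ideal_pow R I r) R"
proof -
  interpret M: comm_monoid "ideals_set R" by (rule ideals_set_is_comm_monoid)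
  show ?thesis
    using M.nat_pow_closed[of I "nat r"] assms oneideal
    by (auto simp: ideal_pow_def ideals_set_def)
qed

lemma ideal_pow_one:
  assumes "ideal I R"
  shows "ideal_pow R I 1 = I"
proof -
  interpret M: comm_monoid "ideals_set R" by (rule ideals_set_is_comm_monoid)
  have "I \<in> carrier (ideals_set R)"
    using assms by (simp add: ideals_set_def)
  thus ?thesis
    using M.nat_pow_eone by (simp add: ideal_pow_def)
qed

text \<open>Equality is restricted to nonnegative exponents: with a = -1 and b = 2 the left side is
  the square of \<open>I\<close>, the right side \<open>I\<close> itself.\<close>

lemma ideal_pow_add_nat:
  assumes "ideal I R" "0 \<le> a" "0 \<le> b"
  shows "ideal_pow R I a \<cdot> ideal_pow R I b = ideal_pow R I (a + b)"
proof -
  interpret M: comm_monoid "ideals_set R" by (rule ideals_set_is_comm_monoid)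
  have nonneg: "ideal_pow R I r = I [^]\<^bsub>ideals_set R\<^esub> nat r" if "0 \<le> r" for r
    using that by (auto simp: ideal_pow_def ideals_set_def)
  show ?thesis
    using M.nat_pow_mult[of I "nat a" "nat b"] assms
    by (simp add: nonneg nat_add_distrib) (simp add: ideals_set_def)
qed

lemma ideal_pow_antimono:
  assumes "ideal I R" "a \<le> b"
  shows "ideal_pow R I b \<subseteq> ideal_pow R I a"
proof (cases "0 \<le> a")
  case True
  hence "ideal_pow R I b = ideal_pow R I a \<cdot> ideal_pow R I (b - a)"
    using ideal_pow_add_nat[of I a "b - a"] assms by simp
  thus ?thesis
    using ideal_prod_inter ideal_ideal_pow assms(1) by blast
next
  case False
  thus ?thesis
    using ideal.Icarr[OF ideal_ideal_pow[OF assms(1), of b]]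
    by (auto simp: ideal_pow_def[of R I a])
qed

text \<open>If one exponent is nonpositive, then a + b is at most the other one, so the other factor
  alone already lies in the required power. This is why the inclusion holds for all
  integers.\<close>

lemma ideal_pow_mult:
  assumes "ideal I R" "x \<in> ideal_pow R I a" "y \<in> ideal_pow R I b"
  shows "x \<otimes> y \<in> ideal_pow R I (a + b)"
proof -
  note id = ideal_ideal_pow[OF assms(1)]
  have xy: "x \<in> carrier R" "y \<in> carrier R"
    using assms(2,3) ideal.Icarr[OF id] by blast+
  consider "a \<le> 0" | "b \<le> 0" | "0 \<le> a" "0 \<le> b" by linarith
  thus ?thesis
  proof cases
    case 1
    hence "y \<in> ideal_pow R I (a + b)"
      using ideal_pow_antimono[OF assms(1), of "a + b" b] assms(3) by auto
    thus ?thesis using ideal.I_l_closed[OF id] xy by blast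
  next
    case 2
    hence "x \<in> ideal_pow R I (a + b)"
      using ideal_pow_antimono[OF assms(1), of "a + b" a] assms(2) by auto
    thus ?thesis using ideal.I_r_closed[OF id] xy by blast
  next
    case 3
    thus ?thesis
      using ideal_pow_add_nat[OF assms(1)] assms(2,3) ideal_prod.prod by metis
  qed
qed

end

section \<open>Powers of ideals across R_n and R_m, tested on slices\<close>

lemma ideal_prod_Rn_mono:
  assumes "A \<subseteq> B" "C \<subseteq> D"
  shows "ideal_prod (Rn n) A C \<subseteq> ideal_prod (Rn m) B D"
proof
  fix x assume "x \<in> ideal_prod (Rn n) A C"
  thus "x \<in> ideal_prod (Rn m) B D"
  proof (induction rule: ideal_prod.induct)
    case (prod i j)
    thus ?case using ideal_prod.prod[of i B j D "Rn m"] assms by auto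
  next
    case (sum x y)
    thus ?case using ideal_prod.sum[of x "Rn m" B D y] by simp
  qed
qed

lemma carrier_Rn_mono: "n \<le> m \<Longrightarrow> carrier (Rn n) \<subseteq> carrier (Rn m)"
  by (fastforce simp: carrier_Rn)

text \<open>The powers are formed in two different rings, but with the same sums and products;
  exponent 0 compares the rings themselves.\<close>

lemma ideal_pow_Rn_mono:
  assumes "n \<le> m" "I \<subseteq> J"
  shows "ideal_pow (Rn n) I r \<subseteq> ideal_pow (Rn m) J r"
proof -
  have "I [^]\<^bsub>ideals_set (Rn n)\<^esub> k \<subseteq> J [^]\<^bsub>ideals_set (Rn m)\<^esub> k" for k :: nat
  proof (induction k)
    case 0
    show ?case using carrier_Rn_mono[OF assms(1)] by (simp add: ideals_set_def)
  next
    case (Suc k)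
    thus ?case
      using ideal_prod_Rn_mono[OF Suc assms(2)] by (simp add: ideals_set_def)
  qed
  thus ?thesis
    by (simp add: ideal_pow_def carrier_Rn_mono[OF assms(1)] del: pow_nat)
qed

text \<open>X^v is a product of |v| variables, each in \<open>q\<close>; the induction splits off
  one variable at a time.\<close>

lemma single_in_ideal_pow:
  assumes "ideal q (Rn m)" "\<And>j. j \<in> A \<Longrightarrow> Poly_Mapping.single (Poly_Mapping.single j 1) 1 \<in> q"
    and "Poly_Mapping.keys v \<subseteq> A"
  shows "Poly_Mapping.single v 1 \<in> ideal_pow (Rn m) q (int (mon_deg v))"
  using assms(3)
proof (induction "mon_deg v" arbitrary: v)
  case 0
  hence "v = 0"
    by (auto simp: mon_deg_def in_keys_iff intro!: poly_mapping_eqI)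
  thus ?case
    by (simp add: ideal_pow_def zero_one_in_Rn)
next
  case (Suc d)
  interpret R: cring "Rn m" by (rule cring_Rn)
  have "Poly_Mapping.keys v \<noteq> {}"
    using Suc.hyps(2) by (auto simp: mon_deg_def)
  then obtain j where j: "j \<in> Poly_Mapping.keys v" by blast
  define w where "w = v - Poly_Mapping.single j 1"
  have v: "v = w + Poly_Mapping.single j 1"
    using j by (intro poly_mapping_eqI) (auto simp: w_def lookup_add lookup_minus lookup_single when_def in_keys_iff)
  have deg: "mon_deg v = mon_deg w + 1"
    unfolding v by (simp add: mon_deg_add) (simp add: mon_deg_def)
  have "Poly_Mapping.keys w \<subseteq> A"
    using Suc.prems unfolding v keys_add_nat by blast
  hence "Poly_Mapping.single w 1 \<in> ideal_pow (Rn m) q (int (mon_deg w))"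
    using Suc.hyps deg by simp
  moreover have "Poly_Mapping.single (Poly_Mapping.single j 1) 1 \<in> ideal_pow (Rn m) q 1"
    using j Suc.prems assms(2) R.ideal_pow_one[OF assms(1)] by blast
  ultimately have "Poly_Mapping.single w 1 * Poly_Mapping.single (Poly_Mapping.single j 1) 1
      \<in> ideal_pow (Rn m) q (int (mon_deg w) + 1)"
    using R.ideal_pow_mult[OF assms(1)] by fastforce
  thus ?case
    unfolding deg by (simp add: mult_single v add.commute)
qed

text \<open>The coefficient of X^v in f g is the sum of the f_u g_w with u + w = v, and (a - |u|) +
  (b - |w|) = a + b - |v|. So the condition on slices behaves like a filtration.\<close>

lemma slice_mult_in_ideal_pow:
  fixes f g :: "'a::field mpol"
  assumes "ideal p (Rn n)"
    and "\<And>v. slice n v f \<in> ideal_pow (Rn n) p (a - int (mon_deg v))"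
    and "\<And>v. slice n v g \<in> ideal_pow (Rn n) p (b - int (mon_deg v))"
  shows "slice n v (f * g) \<in> ideal_pow (Rn n) p (a + b - int (mon_deg v))"
proof -
  interpret R: cring "Rn n" by (rule cring_Rn)
  note id = R.ideal_ideal_pow[OF assms(1)]
  let ?V = "\<lambda>f. mon_part {n<..} ` Poly_Mapping.keys f"
  let ?X = "\<lambda>v. Poly_Mapping.single v (1::'a)"
  have "f * g = (\<Sum>u\<in>?V f. slice n u f * ?X u) * (\<Sum>w\<in>?V g. slice n w g * ?X w)"
    by (simp add: sum_slices)
  also have "\<dots> = (\<Sum>u\<in>?V f. \<Sum>w\<in>?V g. (slice n u f * slice n w g) * ?X (u + w))"
    unfolding sum_product
  proof (intro sum.cong refl)
    fix u w :: "nat \<Rightarrow>\<^sub>0 nat"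
    have "?X (u + w) = ?X u * ?X w"
      by (simp add: mult_single)
    thus "slice n u f * ?X u * (slice n w g * ?X w) = slice n u f * slice n w g * ?X (u + w)"
      by (simp only: mult_ac)
  qed
  finally have "slice n v (f * g) =
      (\<Sum>u\<in>?V f. \<Sum>w\<in>?V g. slice n v ((slice n u f * slice n w g) * ?X (u + w)))"
    by (simp only: slice_sum)
  also have "\<dots> \<in> ideal_pow (Rn n) p (a + b - int (mon_deg v))"
  proof (intro mpol.subspace_sum[OF mpol_subspace_ideal[OF id]])
    fix u w assume "u \<in> ?V f" "w \<in> ?V g"
    hence "Poly_Mapping.keys (u + w) \<subseteq> {n<..}"
      by (auto simp: keys_add_nat keys_mon_part)
    hence "slice n v ((slice n u f * slice n w g) * ?X (u + w)) =
        (if v = u + w then slice n u f * slice n w g else 0)"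
      by (intro slice_mult_single Rn_mult_closed slice_in_Rn)
    moreover have "slice n u f * slice n w g
        \<in> ideal_pow (Rn n) p ((a - int (mon_deg u)) + (b - int (mon_deg w)))"
      using R.ideal_pow_mult[OF assms(1) assms(2)[of u] assms(3)[of w]] by simp
    ultimately show "slice n v ((slice n u f * slice n w g) * ?X (u + w))
        \<in> ideal_pow (Rn n) p (a + b - int (mon_deg v))"
      using mpol.subspace_0[OF mpol_subspace_ideal[OF id]] by (auto simp: mon_deg_add algebra_simps)
  qed
  finally show ?thesis .
qed

text \<open>In the first power only the slice at 0 is constrained: for v other than 0 the exponent 1
  - |v| is nonpositive.\<close>

lemma slice_in_ideal_pow_1:
  assumes "ideal p (Rn n)" "slice n 0 g \<in> p"
  shows "slice n v g \<in> ideal_pow (Rn n) p (1 - int (mon_deg v))"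
proof (cases "v = 0")
  case True
  thus ?thesis using assms cring.ideal_pow_one[OF cring_Rn assms(1)] by simp
next
  case False
  hence "mon_deg v \<noteq> 0"
    by (auto simp: mon_deg_def in_keys_iff intro!: poly_mapping_eqI)
  thus ?thesis using slice_in_Rn by (simp add: ideal_pow_def)
qed

text \<open>The last three hypotheses express, without generators, that \<open>q\<close> is
  generated by \<open>p\<close> and the variables X_{n+1}, ..., X_m.\<close>

lemma ideal_pow_iff_slices:
  assumes "n \<le> m" "ideal p (Rn n)" "ideal q (Rn m)" "p \<subseteq> q"
    and "\<And>f. f \<in> q \<Longrightarrow> slice n 0 f \<in> p"
    and "\<And>j. j \<in> {n<..m} \<Longrightarrow> Poly_Mapping.single (Poly_Mapping.single j 1) 1 \<in> q"
  shows "f \<in> ideal_pow (Rn m) q r \<longleftrightarrow>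
    f \<in> carrier (Rn m) \<and> (\<forall>v. slice n v f \<in> ideal_pow (Rn n) p (r - int (mon_deg v)))"
proof
  interpret Rn: cring "Rn n" by (rule cring_Rn)
  interpret Rm: cring "Rn m" by (rule cring_Rn)
  note idp = Rn.ideal_ideal_pow[OF assms(2)] and idq = Rm.ideal_ideal_pow[OF assms(3)]
  \<comment> \<open>Induction on the power, and inside it on the generation of the ideal product;
    each new factor from \<open>q\<close> satisfies the condition for exponent 1.\<close>
  have nat: "slice n v g \<in> ideal_pow (Rn n) p (int k - int (mon_deg v))"
    if "g \<in> q [^]\<^bsub>ideals_set (Rn m)\<^esub> k" for g v k
    using that
  proof (induction k arbitrary: g v)
    case 0
    show ?case using slice_in_Rn by (simp add: ideal_pow_def)
  next
    case (Suc k)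
    hence "g \<in> ideal_prod (Rn m) (q [^]\<^bsub>ideals_set (Rn m)\<^esub> k) q"
      by (simp add: ideals_set_def)
    thus ?case
    proof (induction arbitrary: v rule: ideal_prod.induct)
      case (prod i j)
      thus ?case
        using slice_mult_in_ideal_pow[OF assms(2), of i "int k" j 1] Suc.IH
          slice_in_ideal_pow_1[OF assms(2,5)] by (simp add: add.commute)
    next
      case (sum x y)
      thus ?case
        using mpol.subspace_add[OF mpol_subspace_ideal[OF idp]] by (simp add: slice_add)
    qed
  qed
  show "f \<in> carrier (Rn m) \<and> (\<forall>v. slice n v f \<in> ideal_pow (Rn n) p (r - int (mon_deg v)))"
    if f: "f \<in> ideal_pow (Rn m) q r"
  proof (intro conjI allI)
    show "f \<in> carrier (Rn m)"
      using f ideal.Icarr[OF idq] by blast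
    \<comment> \<open>For r <= 0 all exponents r - |v| are nonpositive and the claim is only
      membership in R_n.\<close>
    show "slice n v f \<in> ideal_pow (Rn n) p (r - int (mon_deg v))" for v
      using nat[of f "nat r" v] slice_in_Rn f by (auto simp: ideal_pow_def split: if_splits)
  qed
  show "f \<in> ideal_pow (Rn m) q r"
    if f: "f \<in> carrier (Rn m) \<and> (\<forall>v. slice n v f \<in> ideal_pow (Rn n) p (r - int (mon_deg v)))"
  proof -
    let ?V = "mon_part {n<..} ` Poly_Mapping.keys f"
    \<comment> \<open>Each summand has one factor in q^(r - |v|) and one in q^|v|.\<close>
    have "(\<Sum>v\<in>?V. slice n v f * Poly_Mapping.single v 1) \<in> ideal_pow (Rn m) q r"
    proof (intro mpol.subspace_sum[OF mpol_subspace_ideal[OF idq]])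
      fix v assume "v \<in> ?V"
      hence "Poly_Mapping.keys v \<subseteq> {n<..m}"
        using f by (fastforce simp: keys_mon_part carrier_Rn)
      hence "Poly_Mapping.single v 1 \<in> ideal_pow (Rn m) q (int (mon_deg v))"
        using single_in_ideal_pow[OF assms(3,6)] by blast
      moreover have "slice n v f \<in> ideal_pow (Rn m) q (r - int (mon_deg v))"
        using f ideal_pow_Rn_mono[OF assms(1,4)] by blast
      ultimately show "slice n v f * Poly_Mapping.single v 1 \<in> ideal_pow (Rn m) q r"
        using Rm.ideal_pow_mult[OF assms(3)] by fastforce
    qed
    thus ?thesis by (simp add: sum_slices)
  qed
qed

section \<open>Point ideals under the embedding\<close>

lemma ideal_RnI:
  assumes "I \<subseteq> carrier (Rn n)" "0 \<in> I" "\<And>x y. \<lbrakk>x \<in> I; y \<in> I\<rbrakk> \<Longrightarrow> x + y \<in> I"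
    and "\<And>x y. \<lbrakk>x \<in> I; y \<in> carrier (Rn n)\<rbrakk> \<Longrightarrow> x * y \<in> I"
  shows "ideal I (Rn n)"
proof (rule idealI)
  interpret R: cring "Rn n" by (rule cring_Rn)
  show "ring (Rn n)" by (rule R.ring_axioms)
  show "subgroup I (add_monoid (Rn n))"
  proof (rule R.add.subgroupI)
    fix x assume x: "x \<in> I"
    have "- 1 \<in> carrier (Rn n)"
      using mpol.subspace_neg[OF mpol_subspace_Rn zero_one_in_Rn(2)] .
    hence "x * (- 1) \<in> I"
      by (rule assms(4)[OF x])
    thus "\<ominus>\<^bsub>Rn n\<^esub> x \<in> I"
      using x assms(1) by (subst Rn_uminus) auto
  qed (use assms in auto)
qed (use assms(4) in \<open>auto simp: mult.commute\<close>)

text \<open>Padding with zeros kills every monomial that contains a variable beyond X_n, and the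
  slice at 0 collects the others. The bound n + k keeps all indices inside the padded list.\<close>

lemma eval_mpol_append_zeros:
  assumes "f \<in> carrier (Rn (n + k))" "length a = n + 1"
  shows "eval_mpol f (a @ replicate k 0) = eval_mpol (slice n 0 f) a"
proof -
  let ?b = "a @ replicate k 0"
  let ?m = "\<lambda>a u. \<Prod>i\<in>Poly_Mapping.keys u. (a ! i) ^ Poly_Mapping.lookup u i"
  have look: "Poly_Mapping.lookup (slice n 0 f) u =
      (Poly_Mapping.lookup f u when Poly_Mapping.keys u \<subseteq> {0..n})" for u
    by (simp add: lookup_slice)
  have "eval_mpol f ?b = (\<Sum>u\<in>Poly_Mapping.keys (slice n 0 f). Poly_Mapping.lookup f u * ?m ?b u)"
    unfolding eval_mpol_def
  proof (rule sum.mono_neutral_right)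
    show "Poly_Mapping.keys (slice n 0 f) \<subseteq> Poly_Mapping.keys f"
      by (rule subsetI) (simp add: in_keys_iff look when_def split: if_splits)
    show "\<forall>u\<in>Poly_Mapping.keys f - Poly_Mapping.keys (slice n 0 f). Poly_Mapping.lookup f u * ?m ?b u = 0"
    proof
      fix u assume u: "u \<in> Poly_Mapping.keys f - Poly_Mapping.keys (slice n 0 f)"
      hence "\<not> Poly_Mapping.keys u \<subseteq> {0..n}"
        by (auto simp: in_keys_iff[of u] look)
      then obtain i where i: "i \<in> Poly_Mapping.keys u" "n < i"
        by (meson atLeastAtMost_iff le0 not_le subsetI)
      moreover have "Poly_Mapping.keys u \<subseteq> {0..n + k}"
        using u assms(1) by (simp add: carrier_Rn)
      hence "i \<le> n + k"
        using i(1) by (meson subsetD atLeastAtMost_iff)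
      ultimately have "?b ! i = 0"
        using assms(2) by (simp add: nth_append)
      moreover have "Poly_Mapping.lookup u i \<noteq> 0"
        using i(1) by (simp add: in_keys_iff)
      ultimately have "(?b ! i) ^ Poly_Mapping.lookup u i = 0"
        by simp
      hence "?m ?b u = 0"
        using i(1) by (intro prod_zero) auto
      thus "Poly_Mapping.lookup f u * ?m ?b u = 0" by simp
    qed
  qed simp
  also have "\<dots> = eval_mpol (slice n 0 f) a"
    unfolding eval_mpol_def
  proof (intro sum.cong refl arg_cong2[where f = "(*)"] prod.cong)
    fix u assume u: "u \<in> Poly_Mapping.keys (slice n 0 f)"
    hence keys: "Poly_Mapping.keys u \<subseteq> {0..n}"
      using slice_in_Rn[of n 0 f] by (simp add: carrier_Rn)
    thus "Poly_Mapping.lookup f u = Poly_Mapping.lookup (slice n 0 f) u"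
      by (simp add: look)
    fix i assume "i \<in> Poly_Mapping.keys u"
    hence "i \<le> n" using keys by auto
    thus "(?b ! i) ^ Poly_Mapping.lookup u i = (a ! i) ^ Poly_Mapping.lookup u i"
      using assms(2) by (simp add: nth_append)
  qed
  finally show ?thesis .
qed

text \<open>If |v| exceeds t, the truncated degree is harmless because the slice is 0. The second
  claim confines the nonzero slices to a finite set of v.\<close>

lemma slice_in_Rn_comp:
  assumes "f \<in> Rn_comp m t"
  shows "slice n v f \<in> Rn_comp n (t - mon_deg v)"
    and "slice n v f \<noteq> 0 \<Longrightarrow> v \<in> (\<Union>d\<le>t. monomials {n<..m} d)"
proof -
  have *: "mon_deg w + mon_deg v = t \<and> Poly_Mapping.keys w \<subseteq> {0..n} \<and> Poly_Mapping.keys v \<subseteq> {n<..m}"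
    if "w \<in> Poly_Mapping.keys (slice n v f)" for w
  proof -
    have w: "w + v \<in> Poly_Mapping.keys f" "Poly_Mapping.keys w \<subseteq> {0..n}" "Poly_Mapping.keys v \<subseteq> {n<..}"
      using that by (simp_all add: in_keys_iff[of w] in_keys_iff[of "w + v"] lookup_slice when_def split: if_splits)
    hence "w + v \<in> monomials {0..m} t"
      using assms by (simp add: Rn_comp_eq)
    moreover have "{n<..m} = {n<..} \<inter> {0..m}"
      by auto
    ultimately show ?thesis
      using w(2,3) by (simp add: monomials_def keys_add_nat mon_deg_add)
  qed
  show "slice n v f \<in> Rn_comp n (t - mon_deg v)"
    using * by (fastforce simp: Rn_comp_eq monomials_def)
  show "v \<in> (\<Union>d\<le>t. monomials {n<..m} d)" if "slice n v f \<noteq> 0"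
  proof -
    obtain w where "w \<in> Poly_Mapping.keys (slice n v f)"
      using \<open>slice n v f \<noteq> 0\<close> by (metis poly_mapping_eqI in_keys_iff lookup_zero)
    from *[OF this] show ?thesis
      by (auto simp: monomials_def)
  qed
qed

lemma point_ideal_ideal: "ideal (point_ideal n P) (Rn n)"
  unfolding point_ideal_def
  by (rule ring.genideal_ideal[OF cring.axioms(1)[OF cring_Rn]]) (auto simp: Rn_comp_def)

lemma point_ideal_generator:
  assumes "f \<in> Rn_comp n d" "\<And>a. a \<in> P \<Longrightarrow> eval_mpol f a = 0"
  shows "f \<in> point_ideal n P"
  unfolding point_ideal_def
  by (rule subsetD[OF ring.genideal_self[OF cring.axioms(1)[OF cring_Rn]]])
    (use assms in \<open>auto simp: Rn_comp_def\<close>)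

lemma point_ideal_minimal:
  assumes "ideal I (Rn n)"
    and "\<And>f d. \<lbrakk>f \<in> Rn_comp n d; \<And>a. a \<in> P \<Longrightarrow> eval_mpol f a = 0\<rbrakk> \<Longrightarrow> f \<in> I"
  shows "point_ideal n P \<subseteq> I"
  unfolding point_ideal_def
  by (rule ring.genideal_minimal[OF cring.axioms(1)[OF cring_Rn] assms(1)]) (use assms(2) in auto)

lemma length_proj_space: "\<lbrakk>P \<in> proj_space n; a \<in> P\<rbrakk> \<Longrightarrow> length a = n + 1"
  by (auto simp: proj_space_def proj_rel_def nonzero_coords_def quotient_def)

lemma Rn_comp_mono: "n \<le> m \<Longrightarrow> Rn_comp n t \<subseteq> Rn_comp m t"
  using carrier_Rn_mono by (auto simp: Rn_comp_def)

lemma ideal_pow_point_ideal_embed_iff: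
  fixes P :: "'a::field list set"
  assumes "P \<in> proj_space n" "n \<le> m"
  shows "f \<in> ideal_pow (Rn m) (point_ideal m (proj_embed n m P)) r \<longleftrightarrow> f \<in> carrier (Rn m) \<and>
    (\<forall>v. slice n v f \<in> ideal_pow (Rn n) (point_ideal n P) (r - int (mon_deg v)))"
proof (rule ideal_pow_iff_slices[OF assms(2) point_ideal_ideal point_ideal_ideal])
  let ?p = "point_ideal n P" and ?q = "point_ideal m (proj_embed n m P)"
  interpret p: ideal ?p "Rn n" by (rule point_ideal_ideal)
  interpret q: ideal ?q "Rn m" by (rule point_ideal_ideal)
  note p = mpol_subspace_ideal[OF p.ideal_axioms] and q = mpol_subspace_ideal[OF q.ideal_axioms]
  have eval: "eval_mpol g (a @ replicate (m - n) 0) = eval_mpol (slice n 0 g) a"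
    if "a \<in> P" "g \<in> Rn_comp m d" for a g d
    using that assms eval_mpol_append_zeros[of g n "m - n" a] length_proj_space[OF assms(1) that(1)]
    by (simp add: Rn_comp_def)
  \<comment> \<open>\<open>?p\<close> is minimal among ideals of R_n, so it is compared with the
    contraction of \<open>?q\<close> to R_n.\<close>
  have "?p \<subseteq> ?q \<inter> carrier (Rn n)"
  proof (rule point_ideal_minimal)
    show "ideal (?q \<inter> carrier (Rn n)) (Rn n)"
    proof (rule ideal_RnI)
      show "x * y \<in> ?q \<inter> carrier (Rn n)"
        if "x \<in> ?q \<inter> carrier (Rn n)" "y \<in> carrier (Rn n)" for x y
        using that q.I_r_closed[of x y] Rn_mult_closed carrier_Rn_mono[OF assms(2)] by auto
    qed (use mpol.subspace_0[OF q] mpol.subspace_add[OF q] zero_one_in_Rn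
        mpol.subspace_add[OF mpol_subspace_Rn] in auto)
    show "g \<in> ?q \<inter> carrier (Rn n)"
      if g: "g \<in> Rn_comp n d" "\<And>a. a \<in> P \<Longrightarrow> eval_mpol g a = 0" for g d
    proof -
      have "g \<in> Rn_comp m d" "g \<in> carrier (Rn n)"
        using g(1) Rn_comp_mono[OF assms(2)] by (auto simp: Rn_comp_def)
      thus ?thesis
        using eval g(2) by (auto simp: proj_embed_def slice_0_Rn intro!: point_ideal_generator)
    qed
  qed
  thus "?p \<subseteq> ?q" by blast
  \<comment> \<open>On R_m the slice at 0 substitutes 0 for X_{n+1}, ..., X_m, a ring homomorphism
    to R_n; the right side is the preimage of \<open>?p\<close>.\<close>
  have "?q \<subseteq> {g \<in> carrier (Rn m). slice n 0 g \<in> ?p}"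
  proof (rule point_ideal_minimal)
    show "ideal {g \<in> carrier (Rn m). slice n 0 g \<in> ?p} (Rn m)"
    proof (rule ideal_RnI)
      show "x * y \<in> {g \<in> carrier (Rn m). slice n 0 g \<in> ?p}"
        if "x \<in> {g \<in> carrier (Rn m). slice n 0 g \<in> ?p}" "y \<in> carrier (Rn m)" for x y
      proof -
        \<comment> \<open>The exponent is split so that \<open>x\<close> counts with exponent 1 and
          the arbitrary \<open>y\<close> with exponent 0.\<close>
        have "slice n 0 (x * y) \<in> ideal_pow (Rn n) ?p (1 + 0 - int (mon_deg 0))"
          using that slice_in_Rn
          by (intro slice_mult_in_ideal_pow slice_in_ideal_pow_1 p.ideal_axioms) (auto simp: ideal_pow_def)
        thus ?thesis
          using that Rn_mult_closed cring.ideal_pow_one[OF cring_Rn p.ideal_axioms] by auto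
      qed
    qed (use mpol.subspace_0[OF p] mpol.subspace_add[OF p] zero_one_in_Rn
        mpol.subspace_add[OF mpol_subspace_Rn] in \<open>auto simp: slice_add\<close>)
    show "g \<in> {g \<in> carrier (Rn m). slice n 0 g \<in> ?p}"
      if g: "g \<in> Rn_comp m d" "\<And>a. a \<in> proj_embed n m P \<Longrightarrow> eval_mpol g a = 0" for g d
    proof -
      have "slice n 0 g \<in> ?p"
        using slice_in_Rn_comp(1)[OF g(1), of n 0] eval[OF _ g(1)] g(2)
        by (auto simp: proj_embed_def intro!: point_ideal_generator)
      thus ?thesis
        using g(1) by (simp add: Rn_comp_def)
    qed
  qed
  thus "slice n 0 g \<in> ?p" if "g \<in> ?q" for g
    using that by blast
  show "Poly_Mapping.single (Poly_Mapping.single j 1) 1 \<in> ?q" if j: "j \<in> {n<..m}" for j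
  proof (rule point_ideal_generator)
    let ?X = "Poly_Mapping.single (Poly_Mapping.single j 1) (1::'a)"
    show X: "?X \<in> Rn_comp m 1"
      using j by (auto simp: Rn_comp_eq monomials_def mon_deg_def)
    have "j \<in> Poly_Mapping.keys (mon_part {n<..} (Poly_Mapping.single j 1))"
      using j by (simp add: keys_mon_part)
    hence "slice n 0 ?X = 0"
      unfolding slice_single by (metis empty_iff keys_zero)
    thus "eval_mpol ?X a = 0" if "a \<in> proj_embed n m P" for a
      using that eval[OF _ X] by (auto simp: proj_embed_def eval_mpol_def)
  qed
qed

section \<open>The dimension count\<close>

lemma slice_scale: "slice n v (scale_mpol c f) = scale_mpol c (slice n v f)"
  by (rule poly_mapping_eqI) (simp add: lookup_slice when_def)

lemma slice_diff: "slice n v (f - g) = slice n v f - slice n v g"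
  using slice_add[of n v "f - g" g] by simp

text \<open>The space is the direct sum of the W v * X^v, built up one v at a time. The finite
  spanning set is part of the conclusion because \<open>mpol.dim_direct_sum\<close> asks for it at
  the next step.\<close>

lemma dim_graded_sum:
  fixes W :: "(nat \<Rightarrow>\<^sub>0 nat) \<Rightarrow> 'a::field mpol set"
  assumes "finite V"
    and "\<And>v. v \<in> V \<Longrightarrow> Poly_Mapping.keys v \<subseteq> {n<..}"
    and "\<And>v. v \<in> V \<Longrightarrow> mpol.subspace (W v)"
    and "\<And>v. v \<in> V \<Longrightarrow> W v \<subseteq> carrier (Rn n)"
    and "\<And>v. v \<in> V \<Longrightarrow> \<exists>F. finite F \<and> W v \<subseteq> mpol.span F"
  shows "mpol.dim {f. \<forall>v. slice n v f \<in> (if v \<in> V then W v else {0})} = (\<Sum>v\<in>V. mpol.dim (W v)) \<and>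
    (\<exists>F. finite F \<and> {f. \<forall>v. slice n v f \<in> (if v \<in> V then W v else {0})} \<subseteq> mpol.span F)"
  using assms
proof (induction V rule: finite_induct)
  case empty
  have "f = 0" if "\<And>v. slice n v f = 0" for f :: "'a mpol"
    using sum_slices[of "mon_part {n<..} ` Poly_Mapping.keys f" n f] that by simp
  hence "{f :: 'a mpol. \<forall>v. slice n v f \<in> (if v \<in> {} then W v else {0})} = {0}"
    by auto
  moreover have "mpol.dim {0 :: 'a mpol} = 0"
    using mpol.dim_span_eq_card_independent[OF mpol.independent_empty] by simp
  ultimately show ?case
    by (intro conjI exI[of _ "{}"]) simp_all
next
  case (insert w V)
  let ?T = "\<lambda>V. {f. \<forall>v. slice n v f \<in> (if v \<in> V then W v else {0})}"
  let ?M = "\<lambda>h. h * Poly_Mapping.single w (1::'a)"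
  have IH: "mpol.dim (?T V) = (\<Sum>v\<in>V. mpol.dim (W v)) \<and> (\<exists>F. finite F \<and> ?T V \<subseteq> mpol.span F)"
    by (rule insert.IH; rule insert.prems; rule insertI2)
  have w: "Poly_Mapping.keys w \<subseteq> {n<..}" "mpol.subspace (W w)" "W w \<subseteq> carrier (Rn n)"
    using insert.prems(1-3)[OF insertI1] .
  obtain F where F: "finite F" "?T V \<subseteq> mpol.span F"
    using IH by blast
  obtain G where G: "finite G" "W w \<subseteq> mpol.span G"
    using insert.prems(4)[OF insertI1] by blast
  interpret M: Vector_Spaces.linear scale_mpol scale_mpol ?M
    by unfold_locales (simp_all add: distrib_right scale_mpol_mult_left)
  have zero: "0 \<in> W v" if "v \<in> insert w V" for v
    using mpol.subspace_0 insert.prems(2)[OF that] .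
  have subT: "mpol.subspace (?T V)"
    using insert.prems(2) zero
    by (intro mpol.subspaceI)
      (auto simp: slice_add slice_scale mpol.subspace_add mpol.subspace_scale)
  have subM: "mpol.subspace (?M ` W w)"
    by (rule M.subspace_image[OF w(2)])
  have finM: "?M ` W w \<subseteq> mpol.span (?M ` G)" "finite (?M ` G)"
    using G M.span_image[of G] by auto
  have slice_M: "slice n v (?M h) = (if v = w then h else 0)" if "h \<in> W w" for h v
    using slice_mult_single[OF _ w(1)] that w(3) by blast
  \<comment> \<open>Multiplication by X^w is injective on \<open>W w\<close>, since the slice at
    \<open>w\<close> undoes it.\<close>
  have dimM: "mpol.dim (?M ` W w) = mpol.dim (W w)"
  proof -
    obtain B where B: "finite B" "mpol.independent B" "mpol.span B = W w" "card B = mpol.dim (W w)"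
      using mpol.finite_basis_of_subspace[OF w(2) G(2,1)] by blast
    have inj: "inj_on ?M (mpol.span B)"
      unfolding B(3) by (rule inj_onI) (metis slice_M)
    have "mpol.span (?M ` B) = ?M ` W w"
      using M.span_image[of B] B(3) by simp
    moreover have "card (?M ` B) = card B"
      using inj by (intro card_image inj_on_subset[OF inj] mpol.span_superset)
    ultimately show ?thesis
      using mpol.dim_span_eq_card_independent[OF M.independent_injective_image[OF B(2) inj]] B(4) by simp
  qed
  \<comment> \<open>Elements of the first space have slice 0 at \<open>w\<close>, while an element
    of the second is determined by that slice.\<close>
  have "?T V \<inter> ?M ` W w = {0}"
  proof
    show "?T V \<inter> ?M ` W w \<subseteq> {0}"
    proof
      fix x assume x: "x \<in> ?T V \<inter> ?M ` W w"
      then obtain h where h: "h \<in> W w" "x = ?M h" by blast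
      have "slice n w x = 0"
        using x insert.hyps(2) by (auto dest: spec[of _ w])
      thus "x \<in> {0}"
        using slice_M[OF h(1), of w] h(2) by simp
    qed
    show "{0} \<subseteq> ?T V \<inter> ?M ` W w"
      using mpol.subspace_0[OF subT] mpol.subspace_0[OF subM] by blast
  qed
  hence dim: "mpol.dim {u + x | u x. u \<in> ?T V \<and> x \<in> ?M ` W w} = mpol.dim (?T V) + mpol.dim (W w)"
    using mpol.dim_direct_sum[OF subT subM _ F(2,1) finM] dimM by simp
  have eq: "?T (insert w V) = {u + x | u x. u \<in> ?T V \<and> x \<in> ?M ` W w}"
  proof
    show "?T (insert w V) \<subseteq> {u + x | u x. u \<in> ?T V \<and> x \<in> ?M ` W w}"
    proof
      fix f assume f: "f \<in> ?T (insert w V)"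
      hence h: "slice n w f \<in> W w"
        by (auto dest: spec[of _ w])
      have "f - ?M (slice n w f) \<in> ?T V"
        using f slice_M[OF h] insert.hyps(2) by (auto simp: slice_diff split: if_splits)
      moreover have "f = (f - ?M (slice n w f)) + ?M (slice n w f)"
        by simp
      ultimately show "f \<in> {u + x | u x. u \<in> ?T V \<and> x \<in> ?M ` W w}"
        using h by blast
    qed
    show "{u + x | u x. u \<in> ?T V \<and> x \<in> ?M ` W w} \<subseteq> ?T (insert w V)"
    proof
      fix f assume "f \<in> {u + x | u x. u \<in> ?T V \<and> x \<in> ?M ` W w}"
      then obtain u h where uh: "f = u + ?M h" "u \<in> ?T V" "h \<in> W w" by blast
      have "slice n v f = slice n v u + (if v = w then h else 0)" for v
        using uh(1) slice_M[OF uh(3)] by (simp add: slice_add)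
      thus "f \<in> ?T (insert w V)"
        using uh(2,3) insert.hyps(2) by (auto split: if_splits)
    qed
  qed
  have "?T (insert w V) \<subseteq> mpol.span (F \<union> ?M ` G)"
    unfolding eq mpol.span_Un using F(2) finM(1) by blast
  moreover have "mpol.dim (?T (insert w V)) = (\<Sum>v\<in>insert w V. mpol.dim (W v))"
    unfolding eq dim conjunct1[OF IH] using insert.hyps by (simp add: add.commute)
  ultimately show ?case
    using F(1) finM(2) by blast
qed

lemma fat_ideal_ideal: "ideal (fat_ideal n s P r) (Rn n)"
proof (rule ideal_RnI)
  interpret R: cring "Rn n" by (rule cring_Rn)
  have id: "ideal (ideal_pow (Rn n) (point_ideal n (P i)) (r i)) (Rn n)" for i
    by (intro R.ideal_ideal_pow point_ideal_ideal)
  note sub = mpol_subspace_ideal[OF id]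
  show "0 \<in> fat_ideal n s P r"
    using mpol.subspace_0[OF sub] zero_one_in_Rn by (auto simp: fat_ideal_def)
  show "x + y \<in> fat_ideal n s P r" if "x \<in> fat_ideal n s P r" "y \<in> fat_ideal n s P r" for x y
    using that mpol.subspace_add[OF sub] mpol.subspace_add[OF mpol_subspace_Rn]
    by (auto simp: fat_ideal_def)
  show "x * y \<in> fat_ideal n s P r" if "x \<in> fat_ideal n s P r" "y \<in> carrier (Rn n)" for x y
    using that ideal.I_r_closed[OF id] Rn_mult_closed by (auto simp: fat_ideal_def)
qed (auto simp: fat_ideal_def)

text \<open>The test on slices holds for each point separately; exchanging the quantifiers over
  points and over v puts each slice into an intersection of powers in R_n.\<close>

lemma Rn_comp_Int_fat_ideal_embed:
  assumes "n \<le> m" "\<And>i. i \<in> {1..s} \<Longrightarrow> P i \<in> proj_space n"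
  shows "Rn_comp m t \<inter> fat_ideal m s (\<lambda>i. proj_embed n m (P i)) r =
    {f. \<forall>v. slice n v f \<in> (if v \<in> (\<Union>d\<le>t. monomials {n<..m} d)
       then Rn_comp n (t - mon_deg v) \<inter> fat_ideal n s P (\<lambda>i. r i - int (mon_deg v)) else {0})}"
    (is "?L = {f. \<forall>v. slice n v f \<in> (if v \<in> ?V then ?W v else {0})}")
proof -
  have fat: "f \<in> fat_ideal m s (\<lambda>i. proj_embed n m (P i)) r \<longleftrightarrow>
      (\<forall>v. slice n v f \<in> fat_ideal n s P (\<lambda>i. r i - int (mon_deg v)))" if f: "f \<in> carrier (Rn m)" for f
  proof -
    let ?q = "\<lambda>i. point_ideal m (proj_embed n m (P i))" and ?p = "\<lambda>i. point_ideal n (P i)"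
    have "f \<in> fat_ideal m s (\<lambda>i. proj_embed n m (P i)) r \<longleftrightarrow>
        (\<forall>i\<in>{1..s}. f \<in> ideal_pow (Rn m) (?q i) (r i))"
      using f by (simp add: fat_ideal_def)
    also have "\<dots> \<longleftrightarrow> (\<forall>i\<in>{1..s}. \<forall>v. slice n v f \<in> ideal_pow (Rn n) (?p i) (r i - int (mon_deg v)))"
      using f ideal_pow_point_ideal_embed_iff[OF assms(2,1), of _ f] by (intro ball_cong refl) simp
    also have "\<dots> \<longleftrightarrow> (\<forall>v. \<forall>i\<in>{1..s}. slice n v f \<in> ideal_pow (Rn n) (?p i) (r i - int (mon_deg v)))"
      by blast
    also have "\<dots> \<longleftrightarrow> (\<forall>v. slice n v f \<in> fat_ideal n s P (\<lambda>i. r i - int (mon_deg v)))"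
      by (simp add: fat_ideal_def slice_in_Rn)
    finally show ?thesis .
  qed
  show ?thesis
  proof (rule Set.set_eqI, rule iffI)
    fix f assume f: "f \<in> ?L"
    hence comp: "f \<in> Rn_comp m t" and "f \<in> carrier (Rn m)"
      by (simp_all add: Rn_comp_def)
    hence "slice n v f \<in> fat_ideal n s P (\<lambda>i. r i - int (mon_deg v))" for v
      using fat f by blast
    hence "slice n v f \<in> ?W v" "slice n v f \<noteq> 0 \<Longrightarrow> v \<in> ?V" for v
      using slice_in_Rn_comp[OF comp] by blast+
    thus "f \<in> {f. \<forall>v. slice n v f \<in> (if v \<in> ?V then ?W v else {0})}"
      by auto
  next
    fix f assume f: "f \<in> {f. \<forall>v. slice n v f \<in> (if v \<in> ?V then ?W v else {0})}"
    \<comment> \<open>Nothing is known of \<open>f\<close> but its slices. Each monomial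
      \<open>u\<close> appears in the slice of its high part, which bounds its variables and fixes
      its degree.\<close>
    have "u \<in> monomials {0..m} t" if u: "u \<in> Poly_Mapping.keys f" for u
    proof -
      let ?lo = "mon_part {0..n} u" and ?hi = "mon_part {n<..} u"
      have split: "?lo + ?hi = u"
        by (rule poly_mapping_eqI) (auto simp: lookup_mon_part lookup_add when_def)
      have lo: "?lo \<in> Poly_Mapping.keys (slice n ?hi f)"
        using u by (simp add: in_keys_iff lookup_slice split keys_mon_part)
      hence "slice n ?hi f \<noteq> 0" by auto
      hence "?hi \<in> ?V" "slice n ?hi f \<in> ?W ?hi"
        using f by (auto dest!: spec[of _ ?hi] split: if_splits)
      hence "?lo \<in> monomials {0..n} (t - mon_deg ?hi)" "mon_deg ?hi \<le> t" "Poly_Mapping.keys ?hi \<subseteq> {n<..m}"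
        using lo by (auto simp: Rn_comp_eq monomials_def)
      hence "mon_deg (?lo + ?hi) = t" "Poly_Mapping.keys (?lo + ?hi) \<subseteq> {0..m}"
        using assms(1) by (fastforce simp: monomials_def mon_deg_add keys_add_nat)+
      thus ?thesis
        by (simp add: monomials_def split)
    qed
    hence comp: "f \<in> Rn_comp m t"
      by (simp add: Rn_comp_eq)
    have "slice n v f \<in> fat_ideal n s P (\<lambda>i. r i - int (mon_deg v))" for v
      using f mpol.subspace_0[OF mpol_subspace_ideal[OF fat_ideal_ideal[of n s P]]]
      by (auto dest!: spec[of _ v] split: if_splits)
    thus "f \<in> ?L"
      using comp fat by (auto simp: Rn_comp_def)
  qed
qed

lemma dim_Rn_comp_Int_fat_ideal_embed:
  fixes P :: "nat \<Rightarrow> 'a::field list set"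
  assumes "n < m" "\<And>i. i \<in> {1..s} \<Longrightarrow> P i \<in> proj_space n"
  shows "mpol.dim (Rn_comp m t \<inter> fat_ideal m s (\<lambda>i. proj_embed n m (P i)) r) =
    (\<Sum>i\<in>{0..t}. ((m - n - 1 + t - i) choose (t - i)) *
       mpol.dim (Rn_comp n i \<inter> fat_ideal n s P (\<lambda>j. r j - int t + int i)))"
proof -
  let ?D = "\<lambda>d. mpol.dim (Rn_comp n (t - d) \<inter> fat_ideal n s P (\<lambda>i. r i - int d))"
  let ?V = "\<Union>d\<le>t. monomials {n<..m} d"
  have finV: "finite ?V"
    by (simp add: finite_monomials)
  have card: "card (monomials {n<..m} d) = (m - n - 1 + d) choose d" for d
  proof -
    have "{n<..m} = {n + 1..<n + 1 + (m - n)}"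
      using assms(1) by auto
    thus ?thesis
      using card_monomials[of "n + 1" "m - n" d] assms(1) by (simp add: add.commute)
  qed
  have slices: "Rn_comp m t \<inter> fat_ideal m s (\<lambda>i. proj_embed n m (P i)) r =
      {f. \<forall>v. slice n v f \<in> (if v \<in> ?V
         then Rn_comp n (t - mon_deg v) \<inter> fat_ideal n s P (\<lambda>i. r i - int (mon_deg v)) else {0})}"
    by (rule Rn_comp_Int_fat_ideal_embed) (use assms in auto)
  have "mpol.dim (Rn_comp m t \<inter> fat_ideal m s (\<lambda>i. proj_embed n m (P i)) r) = (\<Sum>v\<in>?V. ?D (mon_deg v))"
    unfolding slices
  proof (rule conjunct1[OF dim_graded_sum[OF finV, of n
          "\<lambda>v. Rn_comp n (t - mon_deg v) \<inter> fat_ideal n s P (\<lambda>i. r i - int (mon_deg v))"]])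
    show "Poly_Mapping.keys v \<subseteq> {n<..}" if "v \<in> ?V" for v
      using that by (auto simp: monomials_def)
    show "mpol.subspace (Rn_comp n (t - mon_deg v) \<inter> fat_ideal n s P (\<lambda>i. r i - int (mon_deg v)))" for v
      by (intro mpol.subspace_inter mpol_subspace_Rn_comp mpol_subspace_ideal[OF fat_ideal_ideal])
    show "Rn_comp n (t - mon_deg v) \<inter> fat_ideal n s P (\<lambda>i. r i - int (mon_deg v)) \<subseteq> carrier (Rn n)" for v
      by (auto simp: Rn_comp_def)
    show "\<exists>F. finite F \<and> Rn_comp n (t - mon_deg v) \<inter> fat_ideal n s P (\<lambda>i. r i - int (mon_deg v))
        \<subseteq> mpol.span F" for v
      using Rn_comp_subset_span[of n "t - mon_deg v"]
      by (meson finite_atLeastAtMost finite_imageI finite_monomials inf.coboundedI1)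
  qed
  also have "\<dots> = (\<Sum>d\<le>t. \<Sum>v\<in>monomials {n<..m} d. ?D (mon_deg v))"
    by (rule sum.UNION_disjoint) (simp_all add: finite_monomials, auto simp: monomials_def)
  also have "\<dots> = (\<Sum>d\<le>t. ((m - n - 1 + d) choose d) * ?D d)"
  proof (intro sum.cong refl)
    fix d
    have "(\<Sum>v\<in>monomials {n<..m} d. ?D (mon_deg v)) = (\<Sum>v\<in>monomials {n<..m} d. ?D d)"
      by (intro sum.cong refl) (simp add: monomials_def)
    thus "(\<Sum>v\<in>monomials {n<..m} d. ?D (mon_deg v)) = ((m - n - 1 + d) choose d) * ?D d"
      by (simp add: card)
  qed
  \<comment> \<open>The substitution d = t - i indexes by the degree of the slice and turns the
    exponent r - d into r - t + i.\<close>
  also have "\<dots> = (\<Sum>i\<in>{0..t}. ((m - n - 1 + (t - i)) choose (t - i)) * ?D (t - i))"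
    by (rule sum.reindex_bij_witness[of _ "\<lambda>i. t - i" "\<lambda>i. t - i"]) auto
  also have "\<dots> = (\<Sum>i\<in>{0..t}. ((m - n - 1 + t - i) choose (t - i)) *
       mpol.dim (Rn_comp n i \<inter> fat_ideal n s P (\<lambda>j. r j - int t + int i)))"
    by (intro sum.cong refl) (auto simp: of_nat_diff algebra_simps)
  finally show ?thesis .
qed

theorem theorem4p5:
  fixes n m s t :: nat
    and P :: "nat \<Rightarrow> 'a::alg_closed_field list set"
    and \<mu> :: "nat \<Rightarrow> nat"
  assumes "0 < n" and "n < m"
    and "\<And>i. i \<in> {1..s} \<Longrightarrow> P i \<in> proj_space n"
    and "inj_on P {1..s}"
    and "\<And>i. i \<in> {1..s} \<Longrightarrow> 0 < \<mu> i"
    and "t < fat_reg n s P \<mu>"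
  shows "int (hilbert_fun m (fat_ideal m s (\<lambda>i. proj_embed n m (P i)) (\<lambda>i. int (\<mu> i))) t) =
           int (hilbert_fun n (fat_ideal n s P (\<lambda>i. int (\<mu> i))) t)
           + int ((t + m) choose m) - int ((t + n) choose n)
           - (\<Sum>i\<in>{0..<t}. int ((m - n - 1 + t - i) choose (t - i)) *
                (int ((i + n) choose n)
                 - int (hilbert_fun n (fat_ideal n s P (\<lambda>j. int (\<mu> j) - int t + int i)) i)))"
proof -
  \<comment> \<open>The codimension formula over the integers, stated for general k, d, Q and r
    since it is applied both in R_m and in R_n.\<close>
  have hilb: "int (mpol.dim (Rn_comp k d \<inter> fat_ideal k s Q r)) =
      int ((d + k) choose k) - int (hilbert_fun k (fat_ideal k s Q r) d)"
    for k d r and Q :: "nat \<Rightarrow> 'a list set"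
    using hilbert_fun_add_dim[OF fat_ideal_ideal, of k s Q r d] by linarith
  have "int (mpol.dim (Rn_comp m t \<inter> fat_ideal m s (\<lambda>i. proj_embed n m (P i)) (\<lambda>i. int (\<mu> i)))) =
      (\<Sum>i\<in>{0..t}. int ((m - n - 1 + t - i) choose (t - i)) *
        int (mpol.dim (Rn_comp n i \<inter> fat_ideal n s P (\<lambda>j. int (\<mu> j) - int t + int i))))"
    using dim_Rn_comp_Int_fat_ideal_embed[OF assms(2,3)] by simp
  \<comment> \<open>The term i = t has coefficient 1 and the original exponents, so it equals
    binom(t+n, n) minus the Hilbert value of Z at t; solving for the Hilbert value in R_m gives the
    formula.\<close>
  also have "{0..t} = insert t {0..<t}"
    by auto
  finally show ?thesis
    unfolding hilb by simp
qed

end
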